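(* Let $\mathcal{K}$ be a field, $\Gamma\leq\mathbb{R}$ an additive subgroup, and $\Lambda=\Lambda^{\mathcal{K},\Gamma}$ the associated Novikov field. Two Floer-type complexes $(C_*,\partial_C,\ell_C)$ and $(D_*,\partial_D,\ell_D)$ over $\Lambda$ are filtered chain homotopy equivalent to each other if and only if, for every $k\in\mathbb{Z}$, their degree-$k$ concise barcodes are identical.
   Context: **Novikov field.** $\Lambda=\Lambda^{\mathcal{K},\Gamma}$ is the field of formal sums $\sum_{g\in\Gamma}a_gT^g$ with $a_g\in\mathcal{K}$ such that for every $C\in\mathbb{R}$ only finitely many $g<C$ have $a_g\neq 0$, with power-series addition and multiplication. Its valuation is $\nu(\sum a_gT^g)=\min\{g\mid a_g\neq 0\}$, $\nu(0)=\infty$. **Orthogonalizable spaces.** A non-Archimedean normed vector space over $\Lambda$ is a pair $(C,\ell)$ with $C$ a $\Lambda$-vector space and $\ell\colon C\to\mathbb{R}\cup\{-\infty\}$ (filtration function) satisfying: $\ell(x)=-\infty$ iff $x=0$; $\ell(\lambda x)=\ell(x)-\nu(\lambda)$; $\ell(x+y)\leq\max\{\ell(x),\ell(y)\}$. A finite ordered collection $(w_1,\dots,w_r)$ in $C$ is orthogonal if $\ell(\sum_i\lambda_iw_i)=\max_i\ell(\lambda_iw_i)$ for all $\lambda_i\in\Lambda$. An orthogonalizable $\Lambda$-space is a finite-dimensional non-Archimedean normed vector space admitting an orthogonal basis; subspaces of orthogonalizable spaces (with restricted $\ell$) are again orthogonalizable. **Singular value decomposition.** Let $A\colon C\to D$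 be a $\Lambda$-linear map of rank $r$ between orthogonalizable $\Lambda$-spaces $(C,\ell_C)$, $(D,\ell_D)$. A singular value decomposition of $A$ is a choice of orthogonal ordered bases $(y_1,\dots,y_n)$ of $C$ and $(x_1,\dots,x_m)$ of $D$ such that: $(y_{r+1},\dots,y_n)$ is an orthogonal ordered basis of $\ker A$; $(x_1,\dots,x_r)$ is an orthogonal ordered basis of $\mathrm{Im}\,A$; $Ay_i=x_i$ for $1\leq i\leq r$; and $\ell_C(y_1)-\ell_D(x_1)\geq\cdots\geq\ell_C(y_r)-\ell_D(x_r)$. **Floer-type complex.** A Floer-type complex $(C_*,\partial,\ell)$ over $\Lambda$ is a chain complex $(C_*=\bigoplus_{k\in\mathbb{Z}}C_k,\partial)$ of $\Lambda$-vector spaces ($\partial$ is $\Lambda$-linear, $\partial C_k\subset C_{k-1}$, $\partial^2=0$) together with a function $\ell$ such that each $(C_k,\ell|_{C_k})$ is an orthogonalizable $\Lambda$-space and $\ell(\partial x)\leq\ell(x)$ for each $x\in C_k$. **Filtered homotopy equivalence.** A ($\Lambda$-linear, degree $0$) chain map $\Phi\colon C_*\to D_*$ preserves filtration if $\ell_D(\Phi x)\leq\ell_C(x)$ for all homogeneous $x$. Two chain maps $\Phi,\Psi\colon C_*\to D_*$ are filtered chain homotopic if both preserve filtration and there is a $\Lambda$-linear $K\colon C_*\to D_{*+1}$ with $\Phi-\Psi=\partial_DK+K\partial_C$ and $\ell_D(Kx)\leq\ell_C(x)$ for all homogeneous $x$. $(C_*,\partial_C,\ell_C)$ and $(D_*,\partial_D,\ell_D)$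 are filtered (chain) homotopy equivalent if there are filtration-preserving chain maps $\Phi\colon C_*\to D_*$, $\Psi\colon D_*\to C_*$ with $\Psi\Phi$ filtered chain homotopic to $I_{C_*}$ and $\Phi\Psi$ filtered chain homotopic to $I_{D_*}$. **Barcodes.** For $k\in\mathbb{Z}$ write $\partial_k=\partial|_{C_k}$, $Z_k=\ker\partial_k$. Choose a singular value decomposition $((y_1,\dots,y_n),(x_1,\dots,x_m))$ of $\partial_{k+1}\colon C_{k+1}\to Z_k$ and let $r$ be the rank of $\partial_{k+1}$. The degree-$k$ verbose barcode is the multiset of elements of $(\mathbb{R}/\Gamma)\times[0,\infty]$ consisting of $(\ell(x_i)\bmod\Gamma,\ \ell(y_i)-\ell(x_i))$ for $i=1,\dots,r$ and $(\ell(x_i)\bmod\Gamma,\ \infty)$ for $i=r+1,\dots,m$. Singular value decompositions always exist and this multiset does not depend on the chosen one. The degree-$k$ concise barcode is the submultiset of the verbose barcode consisting of elements whose second coordinate is positive. *)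

theory Defs
  imports Complex_Main "HOL-Library.Extended_Real" "HOL-Library.Multiset"
begin

(* A type of this class stands for an arbitrary additive subgroup of the reals,
   namely the range of to_real; since to_real is an injective homomorphism, the type
   is that subgroup.  The order used on the group is always the one of the reals. *)
class real_subgroup = ab_group_add +
  fixes to_real :: "'a \<Rightarrow> real"
  assumes to_real_add: "to_real (x + y) = to_real x + to_real y"
    and inj_to_real: "inj to_real"
begin

lemma to_real_zero [simp]: "to_real 0 = 0"
  using to_real_add[of 0 0] by simp

lemma to_real_minus: "to_real (- x) = - to_real x"
  using to_real_add[of x "- x"] by simp

lemma to_real_diff: "to_real (x - y) = to_real x - to_real y"
  using to_real_add[of x "- y"] by (simp add: to_real_minus)

end

instantiation real :: real_subgroup
begin
definition to_real_real :: "real \<Rightarrow> real" where "to_real_real x = x"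
instance by standard (auto simp: to_real_real_def inj_def)
end

instantiation int :: real_subgroup
begin
definition to_real_int :: "int \<Rightarrow> real" where "to_real_int n = real_of_int n"
instance by standard (auto simp: to_real_int_def inj_def)
end


section \<open>The Novikov field\<close>

typedef (overloaded) ('k::zero, 'g::real_subgroup) novikov =
  "{a :: 'g \<Rightarrow> 'k. \<forall>C. finite {g. to_real g < C \<and> a g \<noteq> 0}}"
  morphisms coeff Novikov
  by (rule exI[of _ "\<lambda>_. 0"]) simp

setup_lifting type_definition_novikov

lemma novikov_eqI: "(\<And>g. coeff a g = coeff b g) \<Longrightarrow> a = b"
  by (metis coeff_inject ext)

lemma finite_coeff: "finite {g. to_real g < C \<and> coeff a g \<noteq> 0}"
  using coeff[of a] by simp

lemma support_bounded_below:
  fixes a :: "('k::zero, 'g::real_subgroup) novikov"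
  obtains m where "\<And>g. coeff a g \<noteq> 0 \<Longrightarrow> m \<le> to_real g"
proof -
  let ?S = "insert 0 (to_real ` {g. to_real g < 0 \<and> coeff a g \<noteq> 0})"
  have fin: "finite ?S" using finite_coeff[of 0 a] by simp
  have "Min ?S \<le> to_real g" if "coeff a g \<noteq> 0" for g
  proof (cases "to_real g < 0")
    case True
    then show ?thesis using that fin by (intro Min_le) auto
  next
    case False
    moreover have "Min ?S \<le> 0" using fin by (intro Min_le) auto
    ultimately show ?thesis by linarith
  qed
  then show ?thesis using that by blast
qed

definition mul_coeff ::
    "('g::real_subgroup \<Rightarrow> 'k::semiring_0) \<Rightarrow> ('g \<Rightarrow> 'k) \<Rightarrow> 'g \<Rightarrow> 'k" where
  "mul_coeff a b g = (\<Sum>h | a h \<noteq> 0 \<and> b (g - h) \<noteq> 0. a h * b (g - h))"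

lemma mul_coeff_superset:
  assumes "finite S" "{h. a h \<noteq> 0 \<and> b (g - h) \<noteq> 0} \<subseteq> S"
  shows "mul_coeff a b g = (\<Sum>h\<in>S. a h * b (g - h))"
  unfolding mul_coeff_def using assms by (intro sum.mono_neutral_left) auto

lemma mul_coeff_window:
  fixes a b :: "('k::semiring_0, 'g::real_subgroup) novikov"
  assumes "\<And>h. coeff b h \<noteq> 0 \<Longrightarrow> m \<le> to_real h" and "to_real g - m \<le> u"
  shows "mul_coeff (coeff a) (coeff b) g =
      (\<Sum>h | coeff a h \<noteq> 0 \<and> to_real h \<le> u. coeff a h * coeff b (g - h))"
proof (rule mul_coeff_superset)
  show "finite {h. coeff a h \<noteq> 0 \<and> to_real h \<le> u}"
    by (rule finite_subset[OF _ finite_coeff[of "u + 1" a]]) auto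
  show "{h. coeff a h \<noteq> 0 \<and> coeff b (g - h) \<noteq> 0} \<subseteq> {h. coeff a h \<noteq> 0 \<and> to_real h \<le> u}"
  proof safe
    fix h assume "coeff a h \<noteq> 0" "coeff b (g - h) \<noteq> 0"
    then show "to_real h \<le> u" using assms(1)[of "g - h"] assms(2) by (simp add: to_real_diff)
  qed
qed

lemma mul_coeff_commute:
  fixes a b :: "'g::real_subgroup \<Rightarrow> 'k::comm_semiring_0"
  shows "mul_coeff a b g = mul_coeff b a g"
  unfolding mul_coeff_def
  by (rule sum.reindex_bij_witness[of _ "\<lambda>h. g - h" "\<lambda>h. g - h"]) (auto simp: mult.commute)

lemma mul_coeff_nonzero:
  assumes "mul_coeff a b g \<noteq> 0"
  obtains h where "a h \<noteq> 0" "b (g - h) \<noteq> 0"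
proof -
  have "{h. a h \<noteq> 0 \<and> b (g - h) \<noteq> 0} \<noteq> {}"
    using assms unfolding mul_coeff_def by (metis sum.empty)
  then show ?thesis using that by auto
qed

lemma finite_mul_coeff:
  fixes a b :: "('k::semiring_0, 'g::real_subgroup) novikov"
  shows "finite {g. to_real g < C \<and> mul_coeff (coeff a) (coeff b) g \<noteq> 0}"
proof -
  obtain m where m: "\<And>g. coeff a g \<noteq> 0 \<Longrightarrow> m \<le> to_real g"
    using support_bounded_below by blast
  obtain n where n: "\<And>g. coeff b g \<noteq> 0 \<Longrightarrow> n \<le> to_real g"
    using support_bounded_below by blast
  let ?P = "{h. to_real h < C - n \<and> coeff a h \<noteq> 0} \<times> {h. to_real h < C - m \<and> coeff b h \<noteq> 0}"
  have "{g. to_real g < C \<and> mul_coeff (coeff a) (coeff b) g \<noteq> 0} \<subseteq> (\<lambda>(h, k). h + k) ` ?P"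
  proof safe
    fix g :: 'g assume g: "to_real g < C" "mul_coeff (coeff a) (coeff b) g \<noteq> 0"
    then obtain h where h: "coeff a h \<noteq> 0" "coeff b (g - h) \<noteq> 0"
      by (elim mul_coeff_nonzero)
    have "(h, g - h) \<in> ?P"
      using m[OF h(1)] n[OF h(2)] g(1) h by (auto simp: to_real_diff)
    then show "g \<in> (\<lambda>(h, k). h + k) ` ?P" by force
  qed
  moreover have "finite ?P" by (intro finite_cartesian_product finite_coeff)
  ultimately show ?thesis by (rule finite_subset[OF _ finite_imageI])
qed

instantiation novikov :: (comm_ring_1, real_subgroup) comm_ring_1
begin

lift_definition zero_novikov :: "('a, 'b) novikov" is "\<lambda>_. 0" by simp

lift_definition one_novikov :: "('a, 'b) novikov" is "\<lambda>g. if g = 0 then 1 else 0"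
  by (auto intro: finite_subset[of _ "{0}"])

lift_definition plus_novikov :: "('a, 'b) novikov \<Rightarrow> ('a, 'b) novikov \<Rightarrow> ('a, 'b) novikov"
  is "\<lambda>a b g. a g + b g"
proof -
  fix a b :: "'b \<Rightarrow> 'a" and C :: real
  assume a: "\<And>C. finite {g. to_real g < C \<and> a g \<noteq> 0}"
    and b: "\<And>C. finite {g. to_real g < C \<and> b g \<noteq> 0}"
  have "{g. to_real g < C \<and> a g + b g \<noteq> 0} \<subseteq>
      {g. to_real g < C \<and> a g \<noteq> 0} \<union> {g. to_real g < C \<and> b g \<noteq> 0}" by auto
  then show "finite {g. to_real g < C \<and> a g + b g \<noteq> 0}"
    using a b finite_subset by blast
qed

lift_definition uminus_novikov :: "('a, 'b) novikov \<Rightarrow> ('a, 'b) novikov"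
  is "\<lambda>a g. - a g" by simp

definition minus_novikov :: "('a, 'b) novikov \<Rightarrow> ('a, 'b) novikov \<Rightarrow> ('a, 'b) novikov"
  where "minus_novikov a b = a + - b"

lift_definition times_novikov :: "('a, 'b) novikov \<Rightarrow> ('a, 'b) novikov \<Rightarrow> ('a, 'b) novikov"
  is mul_coeff
proof -
  fix a b :: "'b \<Rightarrow> 'a" and C :: real
  assume a: "\<And>C. finite {g. to_real g < C \<and> a g \<noteq> 0}"
    and b: "\<And>C. finite {g. to_real g < C \<and> b g \<noteq> 0}"
  show "finite {g. to_real g < C \<and> mul_coeff a b g \<noteq> 0}"
    using finite_mul_coeff[of C "Novikov a" "Novikov b"] a b by (simp add: Novikov_inverse)
qed

instance
proof
  fix a b c :: "('a, 'b) novikov"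
  show "a * b * c = a * (b * c)"
  proof (rule novikov_eqI)
    fix g :: 'b
    obtain m where m: "\<And>g. coeff a g \<noteq> 0 \<Longrightarrow> m \<le> to_real g"
      using support_bounded_below by blast
    obtain n where n: "\<And>g. coeff b g \<noteq> 0 \<Longrightarrow> n \<le> to_real g"
      using support_bounded_below by blast
    obtain p where p: "\<And>g. coeff c g \<noteq> 0 \<Longrightarrow> p \<le> to_real g"
      using support_bounded_below by blast
    have mul_lb: "x + y \<le> to_real g"
      if "\<And>g. coeff u g \<noteq> 0 \<Longrightarrow> x \<le> to_real g" "\<And>g. coeff v g \<noteq> 0 \<Longrightarrow> y \<le> to_real g"
        "coeff (u * v) g \<noteq> 0" for u v :: "('a, 'b) novikov" and x y g
    proof -
      from that(3) obtain h where "coeff u h \<noteq> 0" "coeff v (g - h) \<noteq> 0"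
        by (auto simp: times_novikov.rep_eq elim: mul_coeff_nonzero)
      then show ?thesis using that(1)[of h] that(2)[of "g - h"] by (simp add: to_real_diff)
    qed
    let ?A = "{h. coeff a h \<noteq> 0 \<and> to_real h \<le> to_real g - n - p}"
    let ?C = "{h. coeff c h \<noteq> 0 \<and> to_real h \<le> to_real g - m - n}"
    have "coeff (a * b * c) g = mul_coeff (coeff c) (coeff (a * b)) g"
      by (simp add: times_novikov.rep_eq mul_coeff_commute)
    also have "\<dots> = (\<Sum>k\<in>?C. coeff c k * coeff (a * b) (g - k))"
      by (rule mul_coeff_window[of _ "m + n"]) (auto intro: mul_lb[OF m n])
    also have "\<dots> = (\<Sum>k\<in>?C. coeff c k * (\<Sum>h\<in>?A. coeff a h * coeff b (g - k - h)))"
    proof (rule sum.cong[OF refl])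
      fix k assume k: "k \<in> ?C"
      have "mul_coeff (coeff a) (coeff b) (g - k) = (\<Sum>h\<in>?A. coeff a h * coeff b (g - k - h))"
        using k p by (intro mul_coeff_window[of _ n]) (auto simp: to_real_diff intro: n)
      then show "coeff c k * coeff (a * b) (g - k) =
          coeff c k * (\<Sum>h\<in>?A. coeff a h * coeff b (g - k - h))"
        by (simp add: times_novikov.rep_eq)
    qed
    also have "\<dots> = (\<Sum>k\<in>?C. \<Sum>h\<in>?A. coeff a h * (coeff c k * coeff b (g - h - k)))"
      by (simp add: sum_distrib_left diff_diff_eq add.commute mult.left_commute)
    also have "\<dots> = (\<Sum>h\<in>?A. coeff a h * (\<Sum>k\<in>?C. coeff c k * coeff b (g - h - k)))"
      by (subst sum.swap) (simp add: sum_distrib_left)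
    also have "\<dots> = (\<Sum>h\<in>?A. coeff a h * coeff (b * c) (g - h))"
    proof (rule sum.cong[OF refl])
      fix h assume h: "h \<in> ?A"
      have "mul_coeff (coeff c) (coeff b) (g - h) = (\<Sum>k\<in>?C. coeff c k * coeff b (g - h - k))"
        using h m by (intro mul_coeff_window[of _ n]) (auto simp: to_real_diff intro: n)
      then show "coeff a h * (\<Sum>k\<in>?C. coeff c k * coeff b (g - h - k)) =
          coeff a h * coeff (b * c) (g - h)"
        by (simp add: times_novikov.rep_eq mul_coeff_commute)
    qed
    also have "\<dots> = mul_coeff (coeff a) (coeff (b * c)) g"
      by (rule mul_coeff_window[of _ "n + p", symmetric]) (auto intro: mul_lb[OF n p])
    also have "\<dots> = coeff (a * (b * c)) g"
      by (simp add: times_novikov.rep_eq)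
    finally show "coeff (a * b * c) g = coeff (a * (b * c)) g" .
  qed
  show "a * b = b * a"
    by (rule novikov_eqI) (simp add: times_novikov.rep_eq mul_coeff_commute)
  show "1 * a = a"
  proof (rule novikov_eqI)
    fix g :: 'b
    have "mul_coeff (coeff 1) (coeff a) g = (\<Sum>h\<in>{0}. coeff 1 h * coeff a (g - h))"
      by (rule mul_coeff_superset) (auto simp: one_novikov.rep_eq split: if_splits)
    then show "coeff (1 * a) g = coeff a g"
      by (simp add: times_novikov.rep_eq one_novikov.rep_eq)
  qed
  show "(a + b) * c = a * c + b * c"
  proof (rule novikov_eqI)
    fix g :: 'b
    obtain p where p: "\<And>g. coeff c g \<noteq> 0 \<Longrightarrow> p \<le> to_real g"
      using support_bounded_below by blast
    let ?S = "{h. (coeff a h \<noteq> 0 \<or> coeff b h \<noteq> 0) \<and> to_real h \<le> to_real g - p}"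
    have fin: "finite ?S"
      by (rule finite_subset[OF _ finite_UnI[OF finite_coeff[of "to_real g - p + 1" a]
              finite_coeff[of "to_real g - p + 1" b]]]) auto
    have bnd: "to_real h \<le> to_real g - p" if "coeff c (g - h) \<noteq> 0" for h
      using p[OF that] by (simp add: to_real_diff)
    have "mul_coeff (coeff (a + b)) (coeff c) g = (\<Sum>h\<in>?S. coeff (a + b) h * coeff c (g - h))"
      using fin by (rule mul_coeff_superset) (auto simp: plus_novikov.rep_eq intro: bnd)
    moreover have "mul_coeff (coeff a) (coeff c) g = (\<Sum>h\<in>?S. coeff a h * coeff c (g - h))"
      using fin by (rule mul_coeff_superset) (auto intro: bnd)
    moreover have "mul_coeff (coeff b) (coeff c) g = (\<Sum>h\<in>?S. coeff b h * coeff c (g - h))"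
      using fin by (rule mul_coeff_superset) (auto intro: bnd)
    ultimately show "coeff ((a + b) * c) g = coeff (a * c + b * c) g"
      by (simp add: times_novikov.rep_eq plus_novikov.rep_eq distrib_right sum.distrib)
  qed
  show "(0::('a, 'b) novikov) \<noteq> 1"
    by (metis one_novikov.rep_eq zero_novikov.rep_eq zero_neq_one)
qed (auto intro!: novikov_eqI
      simp: plus_novikov.rep_eq uminus_novikov.rep_eq zero_novikov.rep_eq minus_novikov_def
        algebra_simps)

end

lemma coeff_sum: "coeff (\<Sum>i\<in>I. f i) g = (\<Sum>i\<in>I. coeff (f i) g)"
  by (induction I rule: infinite_finite_induct)
     (auto simp: zero_novikov.rep_eq plus_novikov.rep_eq)

lemma coeff_diff: "coeff (a - b) g = coeff a g - coeff b g"
  unfolding minus_novikov_def plus_novikov.rep_eq uminus_novikov.rep_eq by simp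

lemma coeff_mult_lower:
  assumes "\<And>g. coeff u g \<noteq> 0 \<Longrightarrow> x \<le> to_real g" "\<And>g. coeff v g \<noteq> 0 \<Longrightarrow> y \<le> to_real g"
    "coeff (u * v) g \<noteq> 0"
  shows "x + y \<le> to_real g"
proof -
  from assms(3) obtain h where "coeff u h \<noteq> 0" "coeff v (g - h) \<noteq> 0"
    by (auto simp: times_novikov.rep_eq elim: mul_coeff_nonzero)
  then show ?thesis using assms(1)[of h] assms(2)[of "g - h"] by (simp add: to_real_diff)
qed

lemma coeff_power_lower:
  assumes "\<And>g. coeff u g \<noteq> 0 \<Longrightarrow> x \<le> to_real g"
  shows "coeff (u ^ n) g \<noteq> 0 \<Longrightarrow> real n * x \<le> to_real g"
proof (induction n arbitrary: g)
  case 0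
  then show ?case by (simp add: one_novikov.rep_eq split: if_splits)
next
  case (Suc n)
  from Suc.prems have "coeff (u * u ^ n) g \<noteq> 0" by simp
  from coeff_mult_lower[OF assms Suc.IH this] show ?case by (simp add: algebra_simps)
qed

lemma one_minus_invertible:
  fixes x :: "('k::comm_ring_1, 'g::real_subgroup) novikov"
  assumes e: "e > 0" and x: "\<And>g. coeff x g \<noteq> 0 \<Longrightarrow> e \<le> to_real g"
  shows "\<exists>y. (1 - x) * y = 1"
proof -
  define P where "P N = (\<Sum>n<N. x ^ n)" for N
  define N where "N r = nat \<lceil>r / e\<rceil> + 1" for r
  have N: "r < real n * e" if "n \<ge> N r" for r n
  proof -
    have "r / e < real (N r)" unfolding N_def by linarith
    also have "\<dots> \<le> real n" using that by simp
    finally show ?thesis using e by (simp add: field_simps)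
  qed
  have van: "coeff (x ^ n) g = 0" if "to_real g \<le> r" "n \<ge> N r" for n g r
    using coeff_power_lower[where n = n and g = g, OF x] N[OF that(2)] that(1) by force
  have stab: "coeff (P n) g = coeff (P (N r)) g" if "to_real g \<le> r" "n \<ge> N r" for n g r
  proof -
    have "(\<Sum>i<n. coeff (x ^ i) g) = (\<Sum>i<N r. coeff (x ^ i) g)"
      using that by (intro sum.mono_neutral_right) (auto intro: van)
    then show ?thesis by (simp add: P_def coeff_sum)
  qed
  have Nmono: "N r \<le> N s" if "r \<le> s" for r s
    unfolding N_def using that e by (intro add_mono nat_mono ceiling_mono divide_right_mono) auto
  define y where "y g = coeff (P (N (to_real g))) g" for g
  have y: "y g = coeff (P (N r)) g" if "to_real g \<le> r" for g r
    unfolding y_def using stab[OF order_refl Nmono[OF that]] by simp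
  have fin: "finite {g. to_real g < C \<and> y g \<noteq> 0}" for C
    by (rule finite_subset[OF _ finite_coeff[of C "P (N C)"]]) (auto simp: y[of _ C])
  define Y where "Y = Novikov y"
  have Y: "coeff Y = y" using fin by (simp add: Y_def Novikov_inverse)
  have x1: "0 \<le> to_real g" if "coeff (1 - x) g \<noteq> 0" for g
    using that x[of g] e by (force simp: coeff_diff one_novikov.rep_eq split: if_splits)
  have "(1 - x) * Y = 1"
  proof (rule novikov_eqI)
    fix g :: 'g
    let ?n = "N (to_real g)"
    have "coeff ((1 - x) * Y) g = coeff ((1 - x) * P ?n) g"
    proof -
      have eq: "y (g - h) = coeff (P ?n) (g - h)" if "coeff (1 - x) h \<noteq> 0" for h
        using x1[OF that] by (intro y) (simp add: to_real_diff)
      then have "{h. coeff (1 - x) h \<noteq> 0 \<and> y (g - h) \<noteq> 0} =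
          {h. coeff (1 - x) h \<noteq> 0 \<and> coeff (P ?n) (g - h) \<noteq> 0}" by auto
      then show ?thesis
        unfolding times_novikov.rep_eq Y mul_coeff_def by (intro sum.cong) (auto simp: eq)
    qed
    also have "(1 - x) * P ?n = 1 - x ^ ?n"
      unfolding P_def by (rule one_diff_power_eq[symmetric])
    also have "coeff (1 - x ^ ?n) g = coeff 1 g"
      using van[of g "to_real g" ?n] by (simp add: coeff_diff)
    finally show "coeff ((1 - x) * Y) g = coeff 1 g" .
  qed
  then show ?thesis by blast
qed

lift_definition monomial :: "'k::zero \<Rightarrow> 'g::real_subgroup \<Rightarrow> ('k, 'g) novikov"
  is "\<lambda>c h g. if g = h then c else 0"
  by (auto intro: finite_subset[of _ "{_}"])

lemma coeff_monomial_mult: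
  "coeff (monomial c h * a) g = c * coeff (a :: ('k::comm_ring_1, 'g::real_subgroup) novikov) (g - h)"
proof -
  have "mul_coeff (coeff (monomial c h)) (coeff a) g =
      (\<Sum>k\<in>{h}. coeff (monomial c h) k * coeff a (g - k))"
    by (rule mul_coeff_superset) (auto simp: monomial.rep_eq split: if_splits)
  then show ?thesis by (simp add: times_novikov.rep_eq monomial.rep_eq)
qed

lemma support_least:
  fixes a :: "('k::zero, 'g::real_subgroup) novikov"
  assumes "coeff a g \<noteq> 0"
  obtains h where "coeff a h \<noteq> 0" "\<And>g. coeff a g \<noteq> 0 \<Longrightarrow> to_real h \<le> to_real g"
proof -
  let ?S = "{k. to_real k < to_real g + 1 \<and> coeff a k \<noteq> 0}"
  have "finite ?S" "g \<in> ?S" using finite_coeff assms by auto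
  then obtain h where h: "h \<in> ?S" "\<And>k. k \<in> ?S \<Longrightarrow> to_real h \<le> to_real k"
    using arg_min_if_finite(1)[of ?S to_real] arg_min_least[of ?S _ to_real] by blast
  have "to_real h \<le> to_real k" if "coeff a k \<noteq> 0" for k
  proof (cases "to_real k < to_real g + 1")
    case True
    then show ?thesis using h(2) that by auto
  next
    case False
    then show ?thesis using h(1) by auto
  qed
  then show ?thesis using that h(1) by blast
qed

lemma novikov_invertible:
  fixes a :: "('k::field, 'g::real_subgroup) novikov"
  assumes "a \<noteq> 0"
  shows "\<exists>b. a * b = 1"
proof -
  obtain g where "coeff a g \<noteq> 0"
    using assms novikov_eqI[of a 0] by (auto simp: zero_novikov.rep_eq)
  then obtain h where h: "coeff a h \<noteq> 0" "\<And>g. coeff a g \<noteq> 0 \<Longrightarrow> to_real h \<le> to_real g"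
    using support_least by blast
  define t where "t = monomial (inverse (coeff a h)) (- h)"
  define x where "x = 1 - t * a"
  have ta: "coeff (t * a) g = inverse (coeff a h) * coeff a (g + h)" for g
    by (simp add: t_def coeff_monomial_mult)
  have pos: "to_real g > 0" if "coeff x g \<noteq> 0" for g
  proof -
    have g0: "g \<noteq> 0"
      using that h(1) by (auto simp: x_def coeff_diff ta one_novikov.rep_eq)
    then have "coeff a (g + h) \<noteq> 0"
      using that by (auto simp: x_def coeff_diff ta one_novikov.rep_eq)
    then have "0 \<le> to_real g" using h(2)[of "g + h"] by (simp add: to_real_add)
    moreover have "to_real g \<noteq> 0" using g0 inj_to_real by (metis injD to_real_zero)
    ultimately show ?thesis by simp
  qed
  obtain e where "e > 0" "\<And>g. coeff x g \<noteq> 0 \<Longrightarrow> e \<le> to_real g"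
  proof (cases "x = 0")
    case True
    then show ?thesis using that[of 1] by (simp add: zero_novikov.rep_eq)
  next
    case False
    then obtain k where "coeff x k \<noteq> 0"
      using novikov_eqI[of x 0] by (auto simp: zero_novikov.rep_eq)
    then obtain k' where "coeff x k' \<noteq> 0" "\<And>g. coeff x g \<noteq> 0 \<Longrightarrow> to_real k' \<le> to_real g"
      using support_least by blast
    then show ?thesis using that[of "to_real k'"] pos by auto
  qed
  then obtain y where "(1 - x) * y = 1" using one_minus_invertible by blast
  then have "a * (t * y) = 1" by (simp add: x_def mult.assoc[symmetric] mult.commute[of a t])
  then show ?thesis by blast
qed

instantiation novikov :: (field, real_subgroup) field
begin

definition inverse_novikov :: "('a, 'b) novikov \<Rightarrow> ('a, 'b) novikov"
  where "inverse_novikov a = (if a = 0 then 0 else (SOME b. a * b = 1))"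

definition divide_novikov :: "('a, 'b) novikov \<Rightarrow> ('a, 'b) novikov \<Rightarrow> ('a, 'b) novikov"
  where "divide_novikov a b = a * inverse b"

instance
proof
  fix a b :: "('a, 'b) novikov"
  show "inverse a * a = 1" if "a \<noteq> 0"
    using someI_ex[OF novikov_invertible[OF that]] that
    by (subst mult.commute) (simp add: inverse_novikov_def)
qed (auto simp: inverse_novikov_def divide_novikov_def)

end

(* The infimum is attained for a nonzero element (support_least) and is \<infinity> for 0. *)
definition val :: "('k::zero, 'g::real_subgroup) novikov \<Rightarrow> ereal" where
  "val a = (INF g\<in>{g. coeff a g \<noteq> 0}. ereal (to_real g))"


section \<open>Orthogonalizable spaces and singular value decompositions\<close>

(* A normed space is a subspace V of an ambient vector space; the filtration function is only
   constrained on V.  Its values lie in the reals together with - \<infinity>. *)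
definition nonarch_normed_space ::
    "(('k::field, 'g::real_subgroup) novikov \<Rightarrow> 'v::ab_group_add \<Rightarrow> 'v) \<Rightarrow> 'v set \<Rightarrow>
      ('v \<Rightarrow> ereal) \<Rightarrow> bool" where
  "nonarch_normed_space scl V l \<longleftrightarrow>
     vector_space scl \<and> module.subspace scl V \<and>
     (\<forall>x\<in>V. l x \<noteq> \<infinity>) \<and>
     (\<forall>x\<in>V. l x = - \<infinity> \<longleftrightarrow> x = 0) \<and>
     (\<forall>c. \<forall>x\<in>V. l (scl c x) = l x - val c) \<and>
     (\<forall>x\<in>V. \<forall>y\<in>V. l (x + y) \<le> max (l x) (l y))"

(* For the empty list the supremum is - \<infinity>, the value of a filtration function at 0. *)
definition orthogonal ::
    "('s \<Rightarrow> 'v::ab_group_add \<Rightarrow> 'v) \<Rightarrow> ('v \<Rightarrow> ereal) \<Rightarrow> 'v list \<Rightarrow> bool" where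
  "orthogonal scl l ws \<longleftrightarrow>
     (\<forall>c :: nat \<Rightarrow> 's. l (\<Sum>i<length ws. scl (c i) (ws ! i)) =
        (SUP i\<in>{..<length ws}. l (scl (c i) (ws ! i))))"

definition orthogonal_basis ::
    "('s::field \<Rightarrow> 'v::ab_group_add \<Rightarrow> 'v) \<Rightarrow> ('v \<Rightarrow> ereal) \<Rightarrow> 'v set \<Rightarrow> 'v list \<Rightarrow> bool" where
  "orthogonal_basis scl l V ws \<longleftrightarrow>
     distinct ws \<and> \<not> module.dependent scl (set ws) \<and> module.span scl (set ws) = V \<and>
     orthogonal scl l ws"

definition orthogonalizable ::
    "(('k::field, 'g::real_subgroup) novikov \<Rightarrow> 'v::ab_group_add \<Rightarrow> 'v) \<Rightarrow> 'v set \<Rightarrow>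
      ('v \<Rightarrow> ereal) \<Rightarrow> bool" where
  "orthogonalizable scl V l \<longleftrightarrow>
     nonarch_normed_space scl V l \<and> (\<exists>ws. orthogonal_basis scl l V ws)"

(* Meaningful when A is linear and maps the orthogonalizable space V into the orthogonalizable
   space W; these hypotheses are not repeated here. *)
definition singular_value_decomposition ::
    "('s::field \<Rightarrow> 'v::ab_group_add \<Rightarrow> 'v) \<Rightarrow> 'v set \<Rightarrow> ('v \<Rightarrow> ereal) \<Rightarrow>
     ('s \<Rightarrow> 'w::ab_group_add \<Rightarrow> 'w) \<Rightarrow> 'w set \<Rightarrow> ('w \<Rightarrow> ereal) \<Rightarrow>
     ('v \<Rightarrow> 'w) \<Rightarrow> 'v list \<Rightarrow> 'w list \<Rightarrow> bool" where
  "singular_value_decomposition sclV V lV sclW W lW A ys xs \<longleftrightarrow>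
     (let r = vector_space.dim sclW (A ` V) in
        orthogonal_basis sclV lV V ys \<and>
        orthogonal_basis sclW lW W xs \<and>
        orthogonal_basis sclV lV {v \<in> V. A v = 0} (drop r ys) \<and>
        orthogonal_basis sclW lW (A ` V) (take r xs) \<and>
        (\<forall>i<r. A (ys ! i) = xs ! i) \<and>
        (\<forall>i j. i \<le> j \<and> j < r \<longrightarrow>
           lV (ys ! j) - lW (xs ! j) \<le> lV (ys ! i) - lW (xs ! i)))"


section \<open>Floer-type complexes\<close>

(* The whole type 'v is the total space, of which the grading gives the homogeneous parts. *)
record ('s, 'v) filtered_complex =
  scl :: "'s \<Rightarrow> 'v \<Rightarrow> 'v"
  grading :: "int \<Rightarrow> 'v set"
  bd :: "'v \<Rightarrow> 'v"
  filt :: "'v \<Rightarrow> ereal"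

definition direct_sum_decomposition :: "(int \<Rightarrow> 'v::ab_group_add set) \<Rightarrow> bool" where
  "direct_sum_decomposition G \<longleftrightarrow>
     (\<forall>x. \<exists>!c. (\<forall>k. c k \<in> G k) \<and> finite {k. c k \<noteq> 0} \<and> x = (\<Sum>k | c k \<noteq> 0. c k))"

definition floer_type_complex ::
    "(('k::field, 'g::real_subgroup) novikov, 'v::ab_group_add) filtered_complex \<Rightarrow> bool" where
  "floer_type_complex C \<longleftrightarrow>
     vector_space (scl C) \<and>
     direct_sum_decomposition (grading C) \<and>
     Vector_Spaces.linear (scl C) (scl C) (bd C) \<and>
     (\<forall>k. bd C ` grading C k \<subseteq> grading C (k - 1)) \<and>
     (\<forall>x. bd C (bd C x) = 0) \<and>
     (\<forall>k. orthogonalizable (scl C) (grading C k) (filt C)) \<and>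
     (\<forall>k. \<forall>x\<in>grading C k. filt C (bd C x) \<le> filt C x)"

definition chain_map ::
    "('s::field, 'v::ab_group_add) filtered_complex \<Rightarrow> ('s, 'w::ab_group_add) filtered_complex \<Rightarrow>
      ('v \<Rightarrow> 'w) \<Rightarrow> bool" where
  "chain_map C D \<Phi> \<longleftrightarrow>
     Vector_Spaces.linear (scl C) (scl D) \<Phi> \<and>
     (\<forall>k. \<Phi> ` grading C k \<subseteq> grading D k) \<and>
     (\<forall>x. \<Phi> (bd C x) = bd D (\<Phi> x))"

definition preserves_filtration ::
    "('s, 'v) filtered_complex \<Rightarrow> ('s, 'w) filtered_complex \<Rightarrow> ('v \<Rightarrow> 'w) \<Rightarrow> bool" where
  "preserves_filtration C D \<Phi> \<longleftrightarrow> (\<forall>k. \<forall>x\<in>grading C k. filt D (\<Phi> x) \<le> filt C x)"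

definition filtered_chain_homotopic ::
    "('s::field, 'v::ab_group_add) filtered_complex \<Rightarrow> ('s, 'w::ab_group_add) filtered_complex \<Rightarrow>
      ('v \<Rightarrow> 'w) \<Rightarrow> ('v \<Rightarrow> 'w) \<Rightarrow> bool" where
  "filtered_chain_homotopic C D \<Phi> \<Psi> \<longleftrightarrow>
     preserves_filtration C D \<Phi> \<and> preserves_filtration C D \<Psi> \<and>
     (\<exists>K. Vector_Spaces.linear (scl C) (scl D) K \<and>
          (\<forall>k. K ` grading C k \<subseteq> grading D (k + 1)) \<and>
          (\<forall>x. \<Phi> x - \<Psi> x = bd D (K x) + K (bd C x)) \<and>
          preserves_filtration C D K)"

definition filtered_homotopy_equivalent ::
    "('s::field, 'v::ab_group_add) filtered_complex \<Rightarrow> ('s, 'w::ab_group_add) filtered_complex \<Rightarrow>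
      bool" where
  "filtered_homotopy_equivalent C D \<longleftrightarrow>
     (\<exists>\<Phi> \<Psi>. chain_map C D \<Phi> \<and> preserves_filtration C D \<Phi> \<and>
            chain_map D C \<Psi> \<and> preserves_filtration D C \<Psi> \<and>
            filtered_chain_homotopic C C (\<Psi> \<circ> \<Phi>) id \<and>
            filtered_chain_homotopic D D (\<Phi> \<circ> \<Psi>) id)"


section \<open>Barcodes\<close>

(* The class of a real number modulo the subgroup, as a coset; the subgroup is passed as a type. *)
definition residue_class :: "'g::real_subgroup itself \<Rightarrow> real \<Rightarrow> real set" where
  "residue_class _ a = (\<lambda>g :: 'g. a + to_real g) ` UNIV"

definition cycles ::
    "('s, 'v::ab_group_add) filtered_complex \<Rightarrow> int \<Rightarrow> 'v set" where
  "cycles C k = {x \<in> grading C k. bd C x = 0}"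

definition boundary_svd ::
    "('s::field, 'v::ab_group_add) filtered_complex \<Rightarrow> int \<Rightarrow> 'v list \<Rightarrow> 'v list \<Rightarrow> bool" where
  "boundary_svd C k ys xs \<longleftrightarrow>
     singular_value_decomposition (scl C) (grading C (k + 1)) (filt C)
       (scl C) (cycles C k) (filt C) (bd C) ys xs"

definition svd_barcode ::
    "(('k::field, 'g::real_subgroup) novikov, 'v::ab_group_add) filtered_complex \<Rightarrow> int \<Rightarrow>
      'v list \<Rightarrow> 'v list \<Rightarrow> (real set \<times> ereal) multiset" where
  "svd_barcode C k ys xs =
     (let r = vector_space.dim (scl C) (bd C ` grading C (k + 1)) in
        {# (residue_class TYPE('g) (real_of_ereal (filt C (xs ! i))),
            if i < r then filt C (ys ! i) - filt C (xs ! i) else \<infinity>).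
           i \<in># mset [0..<length xs] #})"

(* The barcode of a Floer-type complex is the same for all singular value decompositions;
   SOME picks one of them. *)
definition verbose_barcode ::
    "(('k::field, 'g::real_subgroup) novikov, 'v::ab_group_add) filtered_complex \<Rightarrow> int \<Rightarrow>
      (real set \<times> ereal) multiset" where
  "verbose_barcode C k =
     (case (SOME (ys, xs). boundary_svd C k ys xs) of (ys, xs) \<Rightarrow> svd_barcode C k ys xs)"

definition concise_barcode ::
    "(('k::field, 'g::real_subgroup) novikov, 'v::ab_group_add) filtered_complex \<Rightarrow> int \<Rightarrow>
      (real set \<times> ereal) multiset" where
  "concise_barcode C k = filter_mset (\<lambda>b. snd b > 0) (verbose_barcode C k)"

end

theory Submission
  imports Defs
begin

text \<open>
  A singular value decomposition is built by Gaussian elimination with pivots of least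
  \<open>\<ell>(y) - \<ell>(A y)\<close>.

  Barcodes of homotopy equivalent complexes agree because the number of degree \<open>k\<close> bars in the class
  of \<open>a\<close> that are longer than \<open>b \<ge> 0\<close> is the dimension over the coefficient field of
  \<open>Z\<^sub>k\<^bsup>\<le>a\<^esup> / (Z\<^sub>k\<^bsup><a\<^esup> + {\<partial>y \<in> Z\<^sub>k\<^bsup>\<le>a\<^esup>. \<ell>(y) \<le> a + b})\<close>: on this quotient the two
  composites of a homotopy equivalence act as the identity, since they move a cycle of level at
  most \<open>a\<close> by the boundary of a chain of level at most \<open>a\<close>.

  Conversely, singular value bases of two complexes with equal concise barcodes can be matched bar
  by bar up to factors \<open>T\<^sup>g\<close>; the bars of length zero are sent to zero, and a filtered homotopy
  cancels them.
\<close>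

section \<open>Valuations\<close>

text \<open>The quotient of the overview is never formed. For a bar with cycle \<open>x\<close> and
  \<open>\<ell>(x) = a + g\<close>, its coordinate there is the coefficient of \<open>T^g\<close> at
  \<open>x\<close>, the part of level exactly \<open>a\<close>; taking this coefficient turns a
  problem over the Novikov field, whose dimensions do not see levels, into one over the coefficient
  field. The dimension count then splits into two facts about a single complex: a cycle whose
  coordinates at the long bars vanish is zero in the quotient (\<open>cycle_decomposition\<close>),
  and the long bars are independent in it (\<open>long_bars_independent\<close>). A homogeneous
  linear system with more unknowns than equations joins them. The restriction
  \<open>b \<ge> 0\<close> is dictated by the homotopy: its correction bounds a chain of level
  \<open>a\<close>, and this is killed in the quotient only if \<open>a \<le> a + b\<close>. Bars of
  length zero therefore escape the count, and the converse has to cancel exactly these. Everything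
  rests on expansions in orthogonal bases: no term lies above the level of the sum, so estimates are
  checked term by term.\<close>

lemma val_zero [simp]: "val (0 :: ('k::comm_ring_1, 'g::real_subgroup) novikov) = \<infinity>"
  by (simp add: val_def zero_novikov.rep_eq top_ereal_def)

lemma val_le: "coeff a g \<noteq> 0 \<Longrightarrow> val a \<le> ereal (to_real g)"
  unfolding val_def by (rule INF_lower) simp

lemma coeff_zero_below_val: "ereal (to_real g) < val a \<Longrightarrow> coeff a g = 0"
  using val_le[of a g] by force

lemma val_attained:
  fixes a :: "('k::comm_ring_1, 'g::real_subgroup) novikov"
  assumes "a \<noteq> 0"
  obtains g where "coeff a g \<noteq> 0" "val a = ereal (to_real g)"
proof -
  obtain g where "coeff a g \<noteq> 0"
    using assms novikov_eqI[of a 0] by (auto simp: zero_novikov.rep_eq)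
  then obtain h where h: "coeff a h \<noteq> 0" "\<And>g. coeff a g \<noteq> 0 \<Longrightarrow> to_real h \<le> to_real g"
    using support_least by blast
  have "val a = ereal (to_real h)"
    unfolding val_def by (rule antisym) (auto intro!: INF_lower INF_greatest h)
  then show ?thesis using that h(1) by blast
qed

lemma val_monomial:
  "c \<noteq> 0 \<Longrightarrow> val (monomial c g :: ('k::comm_ring_1, 'g::real_subgroup) novikov) = ereal (to_real g)"
proof -
  assume "c \<noteq> 0"
  then have "{h. coeff (monomial c g) h \<noteq> 0} = {g}" by (auto simp: monomial.rep_eq)
  then show ?thesis by (simp add: val_def)
qed

lemma one_eq_monomial: "(1 :: ('k::comm_ring_1, 'g::real_subgroup) novikov) = monomial 1 0"
  by (rule novikov_eqI) (simp add: one_novikov.rep_eq monomial.rep_eq)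

lemma minus_one_eq_monomial: "(-1 :: ('k::comm_ring_1, 'g::real_subgroup) novikov) = monomial (-1) 0"
  by (rule novikov_eqI) (simp add: one_novikov.rep_eq monomial.rep_eq uminus_novikov.rep_eq)

lemma monomial_mult:
  "monomial a g * monomial b h = (monomial (a * b) (g + h) :: ('k::comm_ring_1, 'g::real_subgroup) novikov)"
  by (rule novikov_eqI) (auto simp: coeff_monomial_mult monomial.rep_eq)

lemma monomial_eq_0_iff [simp]:
  "monomial a g = (0 :: ('k::comm_ring_1, 'g::real_subgroup) novikov) \<longleftrightarrow> a = 0"
proof
  assume "monomial a g = (0 :: ('k, 'g) novikov)"
  then have "coeff (monomial a g) g = coeff (0 :: ('k, 'g) novikov) g" by simp
  then show "a = 0" by (simp add: monomial.rep_eq zero_novikov.rep_eq)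
qed (auto intro!: novikov_eqI simp: monomial.rep_eq zero_novikov.rep_eq)

lemma monomial_zero [simp]: "monomial 0 g = (0 :: ('k::comm_ring_1, 'g::real_subgroup) novikov)"
  by simp

section \<open>Orthogonal families\<close>

locale nonarch_space = vector_space scl
  for scl :: "('k::field, 'g::real_subgroup) novikov \<Rightarrow> 'v::ab_group_add \<Rightarrow> 'v" +
  fixes V :: "'v set" and l :: "'v \<Rightarrow> ereal"
  assumes normed: "nonarch_normed_space scl V l"
begin

lemma subspace_V: "subspace V"
  using normed by (simp add: nonarch_normed_space_def)

lemma l_ne_PInf [simp]: "x \<in> V \<Longrightarrow> l x \<noteq> \<infinity>"
  and l_eq_MInf_iff: "x \<in> V \<Longrightarrow> l x = -\<infinity> \<longleftrightarrow> x = 0"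
  and l_scale: "x \<in> V \<Longrightarrow> l (scl c x) = l x - val c"
  and l_add: "x \<in> V \<Longrightarrow> y \<in> V \<Longrightarrow> l (x + y) \<le> max (l x) (l y)"
  using normed by (auto simp: nonarch_normed_space_def)

lemma l_zero [simp]: "l 0 = -\<infinity>"
  using l_eq_MInf_iff[of 0] subspace_0[OF subspace_V] by simp

lemma l_real: "x \<in> V \<Longrightarrow> x \<noteq> 0 \<Longrightarrow> l x = ereal (real_of_ereal (l x))"
  using l_ne_PInf[of x] l_eq_MInf_iff[of x] by (cases "l x") auto

lemma l_minus: "x \<in> V \<Longrightarrow> l (- x) = l x"
proof -
  assume "x \<in> V"
  then have "l (scl (- 1) x) = l x - val (- 1 :: ('k, 'g) novikov)" by (rule l_scale)
  moreover have "val (- 1 :: ('k, 'g) novikov) = 0"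
    unfolding minus_one_eq_monomial by (simp add: val_monomial zero_ereal_def)
  ultimately show ?thesis by (simp add: scale_minus_left)
qed

lemma l_diff: "x \<in> V \<Longrightarrow> y \<in> V \<Longrightarrow> l (x - y) \<le> max (l x) (l y)"
  using l_add[of x "- y"] l_minus[of y] subspace_neg[OF subspace_V, of y] by simp

lemma V_sum_scale: "(\<And>i. i \<in> I \<Longrightarrow> f i \<in> V) \<Longrightarrow> (\<Sum>i\<in>I. scl (c i) (f i)) \<in> V"
  by (intro subspace_sum subspace_scale subspace_V)

lemma l_sum_le: "(\<And>i. i \<in> I \<Longrightarrow> f i \<in> V) \<Longrightarrow> (\<And>i. i \<in> I \<Longrightarrow> l (f i) \<le> t) \<Longrightarrow> l (sum f I) \<le> t"
proof (induction I rule: infinite_finite_induct)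
  case (insert i I)
  have "l (f i + sum f I) \<le> max (l (f i)) (l (sum f I))"
    using insert.prems by (intro l_add subspace_sum subspace_V) auto
  also have "\<dots> \<le> t" using insert by auto
  finally show ?case using insert.hyps by simp
qed auto

lemma l_sum_less:
  assumes "finite I" "\<And>i. i \<in> I \<Longrightarrow> f i \<in> V" "\<And>i. i \<in> I \<Longrightarrow> l (f i) < t" "t \<noteq> -\<infinity>"
  shows "l (sum f I) < t"
proof (cases "I = {}")
  case False
  have "l (sum f I) \<le> Max ((\<lambda>i. l (f i)) ` I)"
    using assms by (intro l_sum_le) auto
  also have "\<dots> < t" using assms False by (subst Max_less_iff) auto
  finally show ?thesis .
qed (use assms(4) in \<open>auto simp: less_le\<close>)

text \<open>The inequality opposite to the one required here is the ultrametric inequality.\<close>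

definition orth_family :: "'i set \<Rightarrow> ('i \<Rightarrow> 'v) \<Rightarrow> bool" where
  "orth_family I f \<longleftrightarrow> finite I \<and> (\<forall>i\<in>I. f i \<in> V \<and> f i \<noteq> 0) \<and>
     (\<forall>c. \<forall>i\<in>I. l (scl (c i) (f i)) \<le> l (\<Sum>j\<in>I. scl (c j) (f j)))"

text \<open>The family is indexed by its own members, so that basis vectors can be exchanged without
  bookkeeping of positions.\<close>

definition orth :: "'v set \<Rightarrow> bool" where
  "orth B \<longleftrightarrow> orth_family B (\<lambda>b. b)"

lemma orth_familyD:
  assumes "orth_family I f"
  shows "finite I" "\<And>i. i \<in> I \<Longrightarrow> f i \<in> V" "\<And>i. i \<in> I \<Longrightarrow> f i \<noteq> 0"
    "\<And>i c. i \<in> I \<Longrightarrow> l (scl (c i) (f i)) \<le> l (\<Sum>j\<in>I. scl (c j) (f j))"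
  using assms unfolding orth_family_def by blast+

lemma orthD:
  assumes "orth B"
  shows "finite B" "\<And>b. b \<in> B \<Longrightarrow> b \<in> V" "\<And>b. b \<in> B \<Longrightarrow> b \<noteq> 0"
    "\<And>b c. b \<in> B \<Longrightarrow> l (scl (c b) b) \<le> l (\<Sum>j\<in>B. scl (c j) j)"
  using orth_familyD[OF assms[unfolded orth_def]] by simp_all

lemma orthI:
  assumes "finite B" "\<And>b. b \<in> B \<Longrightarrow> b \<in> V" "\<And>b. b \<in> B \<Longrightarrow> b \<noteq> 0"
    "\<And>b c. b \<in> B \<Longrightarrow> l (scl (c b) b) \<le> l (\<Sum>j\<in>B. scl (c j) j)"
  shows "orth B"
  using assms unfolding orth_def orth_family_def by blast

lemma scl_zeroI: "x \<in> V \<Longrightarrow> x \<noteq> 0 \<Longrightarrow> l (scl c x) \<le> l 0 \<Longrightarrow> c = 0"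
  using l_eq_MInf_iff[of "scl c x"] subspace_scale[OF subspace_V, of x c] by auto

lemma orth_family_coeff_eq_0:
  assumes "orth_family I f" "(\<Sum>j\<in>I. scl (c j) (f j)) = 0" "i \<in> I"
  shows "c i = 0"
  using orth_familyD[OF assms(1)] assms(2,3) by (metis scl_zeroI)

text \<open>Two equal members with coefficients 1 and -1 would cancel, although no nonzero
  coefficient may occur in a vanishing combination.\<close>

lemma orth_family_inj_on:
  assumes "orth_family I f"
  shows "inj_on f I"
proof (rule inj_onI, rule ccontr)
  fix i j assume ij: "i \<in> I" "j \<in> I" "f i = f j" "i \<noteq> j"
  define c where "c k = (if k = i then 1 else if k = j then -1 else 0 :: ('k, 'g) novikov)" for k
  have "(\<Sum>k\<in>I. scl (c k) (f k)) = (\<Sum>k\<in>{i, j}. scl (c k) (f k))"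
    using ij orth_familyD(1)[OF assms] by (intro sum.mono_neutral_right) (auto simp: c_def)
  also have "\<dots> = 0" using ij by (simp add: c_def)
  finally have "c i = 0" by (rule orth_family_coeff_eq_0[OF assms _ ij(1)])
  then show False by (simp add: c_def)
qed

lemma orth_family_reindex:
  assumes "inj_on f I"
  shows "orth_family I f \<longleftrightarrow> orth (f ` I)"
proof
  assume L: "orth_family I f"
  show "orth (f ` I)"
  proof (rule orthI)
    fix b c assume "b \<in> f ` I"
    then show "l (scl (c b) b) \<le> l (\<Sum>j\<in>f ` I. scl (c j) j)"
      using orth_familyD(4)[OF L, of _ "\<lambda>i. c (f i)"] by (auto simp: sum.reindex[OF assms])
  qed (use orth_familyD[OF L] in auto)
next
  assume R: "orth (f ` I)"
  show "orth_family I f"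
    unfolding orth_family_def
  proof (intro conjI allI ballI)
    show "finite I" using orthD(1)[OF R] assms by (simp add: finite_image_iff)
    fix c i assume i: "i \<in> I"
    have "l (scl ((c \<circ> the_inv_into I f) (f i)) (f i)) \<le>
        l (\<Sum>j\<in>f ` I. scl ((c \<circ> the_inv_into I f) j) j)"
      using orthD(4)[OF R] i by blast
    then show "l (scl (c i) (f i)) \<le> l (\<Sum>j\<in>I. scl (c j) (f j))"
      using i by (simp add: sum.reindex[OF assms] the_inv_into_f_f[OF assms])
  qed (use orthD[OF R] in auto)
qed

lemma orth_image: "orth_family I f \<Longrightarrow> orth (f ` I)"
  using orth_family_reindex orth_family_inj_on by blast

lemma orth_independent: "orth B \<Longrightarrow> independent B"
  using orth_family_coeff_eq_0[of B "\<lambda>b. b"] orthD(1)[of B]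
  unfolding orth_def[symmetric] by (auto simp: dependent_finite)

lemma orth_subset:
  assumes "orth B" "B' \<subseteq> B"
  shows "orth B'"
proof (rule orthI)
  show "finite B'" using orthD(1)[OF assms(1)] assms(2) by (rule finite_subset[rotated])
  fix b and c :: "'v \<Rightarrow> ('k, 'g) novikov" assume b: "b \<in> B'"
  let ?c = "\<lambda>x. if x \<in> B' then c x else 0"
  have "(\<Sum>j\<in>B. scl (?c j) j) = (\<Sum>j\<in>B'. scl (?c j) j)"
    using orthD(1)[OF assms(1)] assms(2) by (intro sum.mono_neutral_right) auto
  then show "l (scl (c b) b) \<le> l (\<Sum>j\<in>B'. scl (c j) j)"
    using orthD(4)[OF assms(1), of b ?c] b assms(2) by auto
qed (use orthD(1-3)[OF assms(1)] assms(2) in \<open>blast+\<close>)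

lemma orth_span_V: "orth B \<Longrightarrow> span B \<subseteq> V"
  using orthD(2)[of B] by (intro span_minimal subspace_V) auto

lemma orth_spanE:
  assumes "orth B" "x \<in> span B"
  obtains c where "x = (\<Sum>b\<in>B. scl (c b) b)" "\<And>b. b \<in> B \<Longrightarrow> l (scl (c b) b) \<le> l x"
  using assms(2) orthD[OF assms(1)] unfolding span_finite[OF orthD(1)[OF assms(1)]] by auto

text \<open>The \<open>X\<close>-part of a combination is expanded over \<open>Z\<close>.
  Orthogonality of \<open>Y \<union> Z\<close> bounds each term of this expansion, the ultrametric
  inequality then bounds the whole \<open>X\<close>-part, and orthogonality of \<open>X\<close>
  bounds its terms.\<close>

lemma orth_replace:
  assumes YZ: "orth (Y \<union> Z)" "Y \<inter> Z = {}" and X: "orth X" "span X = span Z"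
  shows "orth (Y \<union> X)" "Y \<inter> X = {}" "span (Y \<union> X) = span (Y \<union> Z)"
proof -
  have Y: "orth Y" and Z: "orth Z" using YZ(1) orth_subset by blast+
  have fin: "finite Y" "finite Z" "finite X" using orthD(1) Y Z X by auto
  have indep: "independent (Y \<union> Z)" using YZ(1) by (rule orth_independent)
  show sp: "span (Y \<union> X) = span (Y \<union> Z)" by (simp add: span_Un X(2))
  show disj: "Y \<inter> X = {}"
  proof (rule ccontr)
    assume "Y \<inter> X \<noteq> {}"
    then obtain y where y: "y \<in> Y" "y \<in> span Z" using X(2) span_base by blast
    then have "y \<in> span (Y \<union> Z - {y})" using YZ(2) span_mono[of Z "Y \<union> Z - {y}"] by blast
    then show False using indep y(1) by (auto simp: dependent_def)
  qed
  show "orth (Y \<union> X)"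
  proof (rule orthI)
    fix b and c :: "'v \<Rightarrow> ('k, 'g) novikov" assume b: "b \<in> Y \<union> X"
    have "(\<Sum>j\<in>X. scl (c j) j) \<in> span Z"
      unfolding X(2)[symmetric] by (intro span_sum span_scale span_base)
    then obtain e where e: "(\<Sum>j\<in>X. scl (c j) j) = (\<Sum>z\<in>Z. scl (e z) z)"
      unfolding span_finite[OF fin(2)] by auto
    define h where "h x = (if x \<in> Y then c x else e x)" for x
    let ?t = "l (\<Sum>j\<in>Y \<union> X. scl (c j) j)"
    have "(\<Sum>j\<in>Y \<union> X. scl (c j) j) = (\<Sum>j\<in>Y. scl (c j) j) + (\<Sum>z\<in>Z. scl (e z) z)"
      using fin disj by (simp add: sum.union_disjoint e)
    also have "\<dots> = (\<Sum>j\<in>Y. scl (h j) j) + (\<Sum>z\<in>Z. scl (h z) z)"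
      using YZ(2) by (intro arg_cong2[of _ _ _ _ "(+)"] sum.cong) (auto simp: h_def)
    also have "\<dots> = (\<Sum>j\<in>Y \<union> Z. scl (h j) j)"
      using fin YZ(2) by (simp add: sum.union_disjoint)
    finally have t: "?t = l (\<Sum>j\<in>Y \<union> Z. scl (h j) j)" by simp
    have le: "l (scl (h j) j) \<le> ?t" if "j \<in> Y \<union> Z" for j
      unfolding t using that by (rule orthD(4)[OF YZ(1)])
    show "l (scl (c b) b) \<le> ?t"
    proof (cases "b \<in> Y")
      case True
      then show ?thesis using le[of b] by (simp add: h_def)
    next
      case False
      then have "l (scl (c b) b) \<le> l (\<Sum>j\<in>X. scl (c j) j)" using b orthD(4)[OF X(1)] by auto
      also have "\<dots> \<le> ?t"
        unfolding e
      proof (rule l_sum_le)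
        fix z assume z: "z \<in> Z"
        then show "scl (e z) z \<in> V" by (intro subspace_scale subspace_V orthD(2)[OF Z])
        have "h z = e z" using z YZ(2) by (auto simp: h_def)
        then show "l (scl (e z) z) \<le> ?t" using le[of z] z by simp
      qed
      finally show ?thesis .
    qed
  qed (use orthD(1-3)[OF Y] orthD(1-3)[OF X(1)] in auto)
qed

text \<open>The term of \<open>j\<close> carries the full level of \<open>x\<close>. When a
  combination is rewritten over \<open>E\<close>, the coefficient of \<open>j\<close> comes from
  \<open>x\<close> alone, which bounds the multiple of \<open>x\<close>; the other terms of
  \<open>x\<close> are no higher than \<open>x\<close>, so subtracting them bounds the remaining
  terms as well.\<close>

lemma orth_exchange:
  assumes E: "orth E" and x: "x = (\<Sum>e\<in>E. scl (c e) e)" and j: "j \<in> E" "l (scl (c j) j) = l x" "x \<noteq> 0"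
  shows "orth (insert x (E - {j}))" "x \<notin> E - {j}" "span (insert x (E - {j})) = span E"
proof -
  note fin = orthD(1)[OF E]
  have xV: "x \<in> V" unfolding x by (rule V_sum_scale) (rule orthD(2)[OF E])
  have cj: "c j \<noteq> 0" using j l_eq_MInf_iff[OF xV] by auto
  let ?E = "E - {j}"
  have xs: "x = scl (c j) j + (\<Sum>e\<in>?E. scl (c e) e)"
    unfolding x using fin j(1) by (rule sum.remove)
  have spE: "(\<Sum>e\<in>?E. scl (c e) e) \<in> span ?E" by (intro span_sum span_scale span_base)
  show "x \<notin> ?E"
  proof
    assume "x \<in> ?E"
    then have "x - (\<Sum>e\<in>?E. scl (c e) e) \<in> span ?E" using spE by (intro span_diff) (auto intro: span_base)
    then have "scl (c j) j \<in> span ?E" using xs by (metis add_diff_cancel_right')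
    then have "scl (inverse (c j)) (scl (c j) j) \<in> span ?E" by (rule span_scale)
    then have "j \<in> span ?E" using cj by simp
    then show False using orth_independent[OF E] j(1) by (auto simp: dependent_def)
  qed
  then have xn: "x \<notin> ?E" .
  show "span (insert x ?E) = span E"
  proof (rule span_eq[THEN iffD2], intro conjI)
    have "x \<in> span E" unfolding x by (intro span_sum span_scale span_base)
    then show "insert x ?E \<subseteq> span E" by (auto intro: span_base)
    have "x - (\<Sum>e\<in>?E. scl (c e) e) \<in> span (insert x ?E)"
      using spE span_mono[of ?E "insert x ?E"] by (intro span_diff) (auto intro: span_base)
    then have "scl (c j) j \<in> span (insert x ?E)" using xs by (metis add_diff_cancel_right')
    then have "scl (inverse (c j)) (scl (c j) j) \<in> span (insert x ?E)" by (rule span_scale)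
    then have "j \<in> span (insert x ?E)" using cj by simp
    then show "E \<subseteq> span (insert x ?E)" by (auto intro: span_base)
  qed
  show "orth (insert x ?E)"
  proof (rule orthI)
    fix b and d :: "'v \<Rightarrow> ('k, 'g) novikov" assume b: "b \<in> insert x ?E"
    let ?s = "\<Sum>i\<in>insert x ?E. scl (d i) i"
    \<comment> \<open>Coefficients of the combination over \<open>E\<close>, obtained by expanding
      \<open>x\<close>.\<close>
    define h where "h e = (if e = j then d x * c j else d x * c e + d e)" for e
    have "?s = scl (d x) x + (\<Sum>e\<in>?E. scl (d e) e)"
      using fin xn by simp
    also have "\<dots> = scl (d x * c j) j + (\<Sum>e\<in>?E. scl (d x * c e) e) + (\<Sum>e\<in>?E. scl (d e) e)"
      by (subst (2) xs) (simp add: scale_right_distrib scale_sum_right)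
    also have "\<dots> = scl (h j) j + (\<Sum>e\<in>?E. scl (h e) e)"
      by (simp add: h_def scale_left_distrib sum.distrib)
    also have "\<dots> = (\<Sum>e\<in>E. scl (h e) e)"
      using fin j(1) by (rule sum.remove[symmetric])
    finally have s: "?s = (\<Sum>e\<in>E. scl (h e) e)" .
    have le: "l (scl (h e) e) \<le> l ?s" if "e \<in> E" for e
      unfolding s using that by (rule orthD(4)[OF E])
    have dx: "l (scl (d x) x) \<le> l ?s"
    proof -
      have jV: "j \<in> V" "scl (c j) j \<in> V" using orthD(2)[OF E j(1)] subspace_scale[OF subspace_V] by auto
      have "l (scl (d x) x) = l (scl (d x) (scl (c j) j))"
        using jV xV j(2) by (simp only: l_scale[OF xV] l_scale[OF jV(2)])
      also have "\<dots> = l (scl (h j) j)" by (simp add: h_def)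
      also have "\<dots> \<le> l ?s" by (rule le[OF j(1)])
      finally show ?thesis .
    qed
    show "l (scl (d b) b) \<le> l ?s"
    proof (cases "b = x")
      case False
      then have bE: "b \<in> E" "b \<noteq> j" "b \<in> V" using b orthD(2)[OF E] by auto
      have "l (scl (c b) b) \<le> l x" unfolding x using bE(1) by (rule orthD(4)[OF E])
      then have "l (scl (d x) (scl (c b) b)) \<le> l (scl (d x) x)"
        using bE(3) xV by (simp only: l_scale subspace_scale[OF subspace_V] ereal_minus_mono[OF _ order_refl])
      then have 1: "l (scl (d x * c b) b) \<le> l ?s" using dx by simp
      have "scl (d b) b = scl (h b) b - scl (d x * c b) b"
        using bE(2) by (simp add: h_def scale_left_distrib)
      also have "l \<dots> \<le> max (l (scl (h b) b)) (l (scl (d x * c b) b))"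
        using bE(3) by (intro l_diff subspace_scale subspace_V)
      also have "\<dots> \<le> l ?s" using 1 le[OF bE(1)] by simp
      finally show ?thesis .
    qed (use dx in simp)
  qed (use fin orthD[OF E] xV j(3) in auto)
qed

text \<open>Over the old basis only the coefficient of \<open>v\<close> changes, so the terms in
  \<open>B\<close> stay bounded by the sum. By the hypothesis on \<open>a\<close>, each correction
  along \<open>v\<close> is no higher than the term of \<open>B\<close> that causes it, so the term
  of \<open>v\<close> is bounded too.\<close>

lemma orth_shear:
  assumes B: "orth (insert v B)" "v \<notin> B" and a: "\<And>b. b \<in> B \<Longrightarrow> l (scl (a b) v) \<le> l b"
  defines "f \<equiv> \<lambda>b. b - scl (a b) v"
  shows "orth (insert v (f ` B))" "inj_on f B" "v \<notin> f ` B" "span (insert v (f ` B)) = span (insert v B)"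
proof -
  \<comment> \<open>The new vectors are first treated as an indexed family, because the injectivity
    of \<open>f\<close> is not known beforehand: it is a consequence of orthogonality.\<close>
  define F where "F b = (if b = v then v else f b)" for b
  note fin = orthD(1)[OF B(1)]
  have V: "v \<in> V" "\<And>b. b \<in> B \<Longrightarrow> b \<in> V" using orthD(2)[OF B(1)] by auto
  have Fneq: "F b = f b" if "b \<in> B" for b using that B(2) by (auto simp: F_def)
  have FV: "F b \<in> V" if "b \<in> insert v B" for b
    using that V unfolding F_def f_def by (auto intro!: subspace_diff subspace_scale subspace_V)
  have fam: "orth_family (insert v B) F"
    unfolding orth_family_def
  proof (intro conjI ballI allI)
    fix b assume b: "b \<in> insert v B"
    show "F b \<noteq> 0"
    proof
      assume "F b = 0"
      then have "b \<noteq> v" "b = scl (a b) v"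
        using orthD(3)[OF B(1)] by (auto simp: F_def f_def split: if_splits)
      then have "b \<in> span (insert v B - {b})" by (metis insert_Diff_if insertI1 singletonD span_base span_scale)
      then show False using orth_independent[OF B(1)] b by (auto simp: dependent_def)
    qed
  next
    fix c :: "'v \<Rightarrow> ('k, 'g) novikov" and b assume b: "b \<in> insert v B"
    let ?s = "\<Sum>j\<in>insert v B. scl (c j) (F j)"
    define h where "h b = (if b = v then c v - (\<Sum>b\<in>B. c b * a b) else c b)" for b
    have "?s = scl (c v) v + (\<Sum>b\<in>B. scl (c b) (f b))"
      using fin B(2) by (simp add: F_def) (intro sum.cong; auto)
    also have "\<dots> = scl (h v) v + (\<Sum>b\<in>B. scl (c b) b)"
      by (simp add: f_def h_def scale_right_diff_distrib sum_subtractf scale_left_diff_distrib scale_sum_left)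
    also have "(\<Sum>b\<in>B. scl (c b) b) = (\<Sum>b\<in>B. scl (h b) b)"
      using B(2) by (intro sum.cong) (auto simp: h_def)
    finally have s: "?s = (\<Sum>j\<in>insert v B. scl (h j) j)"
      using fin B(2) by simp
    have le: "l (scl (h b) b) \<le> l ?s" if "b \<in> insert v B" for b
      unfolding s using that by (rule orthD(4)[OF B(1)])
    have leB: "l (scl (c b) b) \<le> l ?s" "l (scl (c b * a b) v) \<le> l ?s" if "b \<in> B" for b
    proof -
      have "h b = c b" using that B(2) by (auto simp: h_def)
      then show 1: "l (scl (c b) b) \<le> l ?s" using le[of b] that by simp
      have "l (scl (c b) (scl (a b) v)) \<le> l (scl (c b) b)"
        using a[OF that] V V(2)[OF that]
        by (simp only: l_scale[of "scl (a b) v"] l_scale[of b] subspace_scale[OF subspace_V]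
            ereal_minus_mono[OF _ order_refl])
      then show "l (scl (c b * a b) v) \<le> l ?s" using 1 by simp
    qed
    have lev: "l (scl (c v) v) \<le> l ?s"
    proof -
      have "scl (c v) v = scl (h v) v + (\<Sum>b\<in>B. scl (c b * a b) v)"
        by (simp add: h_def scale_left_diff_distrib scale_sum_left)
      also have "l \<dots> \<le> max (l (scl (h v) v)) (l (\<Sum>b\<in>B. scl (c b * a b) v))"
        using V by (intro l_add V_sum_scale subspace_scale subspace_V)
      also have "\<dots> \<le> l ?s"
        using V le[of v] leB by (auto intro!: l_sum_le subspace_scale subspace_V)
      finally show ?thesis .
    qed
    show "l (scl (c b) (F b)) \<le> l ?s"
    proof (cases "b = v")
      case False
      then have bB: "b \<in> B" using b by simp
      have "scl (c b) (F b) = scl (c b) b - scl (c b * a b) v"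
        using False by (simp add: F_def f_def scale_right_diff_distrib)
      also have "l \<dots> \<le> max (l (scl (c b) b)) (l (scl (c b * a b) v))"
        using V V(2)[OF bB] by (intro l_diff subspace_scale subspace_V)
      also have "\<dots> \<le> l ?s" using leB[OF bB] by simp
      finally show ?thesis .
    qed (use lev in \<open>simp add: F_def\<close>)
  qed (use fin FV in auto)
  have img: "F ` insert v B = insert v (f ` B)"
  proof -
    have "F ` B = f ` B" by (rule image_cong) (simp_all add: Fneq)
    moreover have "F v = v" by (simp add: F_def)
    ultimately show ?thesis by simp
  qed
  have inj: "inj_on F (insert v B)" by (rule orth_family_inj_on[OF fam])
  show "orth (insert v (f ` B))" using orth_image[OF fam] unfolding img .
  show "inj_on f B"
    using inj Fneq by (metis inj_on_cong inj_on_insert)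
  show "v \<notin> f ` B"
    using inj Fneq B(2) unfolding inj_on_def
    by (metis F_def imageE insertCI)
  show "span (insert v (f ` B)) = span (insert v B)"
  proof (rule span_eq[THEN iffD2], intro conjI)
    show "insert v (f ` B) \<subseteq> span (insert v B)"
      unfolding f_def by (auto intro!: span_diff span_scale intro: span_base)
    have "b \<in> span (insert v (f ` B))" if "b \<in> B" for b
    proof -
      have "f b + scl (a b) v \<in> span (insert v (f ` B))"
        using that by (intro span_add span_scale) (auto intro: span_base)
      then show ?thesis by (simp add: f_def)
    qed
    then show "insert v B \<subseteq> span (insert v (f ` B))" by (auto intro: span_base)
  qed
qed

section \<open>Orthogonal lists and orthogonal sets\<close>

lemma orthogonal_iff_orth_family:
  assumes "set ws \<subseteq> V" "0 \<notin> set ws"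
  shows "orthogonal scl l ws \<longleftrightarrow> orth_family {..<length ws} ((!) ws)"
proof -
  have V: "ws ! i \<in> V" "ws ! i \<noteq> 0" if "i < length ws" for i using assms that nth_mem by force+
  have le: "l (\<Sum>i<length ws. scl (c i) (ws ! i)) \<le> (SUP i\<in>{..<length ws}. l (scl (c i) (ws ! i)))" for c
    using V by (intro l_sum_le subspace_scale subspace_V SUP_upper) auto
  have "orthogonal scl l ws \<longleftrightarrow>
      (\<forall>c. (SUP i\<in>{..<length ws}. l (scl (c i) (ws ! i))) \<le> l (\<Sum>i<length ws. scl (c i) (ws ! i)))"
    unfolding orthogonal_def using le by (auto intro: antisym)
  also have "\<dots> \<longleftrightarrow> orth_family {..<length ws} ((!) ws)"
    unfolding orth_family_def SUP_le_iff using V by auto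
  finally show ?thesis .
qed

lemma orthogonal_basis_iff:
  assumes "U \<subseteq> V"
  shows "orthogonal_basis scl l U ws \<longleftrightarrow> distinct ws \<and> orth (set ws) \<and> span (set ws) = U"
proof -
  have "orthogonal scl l ws \<longleftrightarrow> orth (set ws)"
    if "distinct ws" "set ws \<subseteq> V" "0 \<notin> set ws"
  proof -
    have "inj_on ((!) ws) {..<length ws}" using that(1) by (simp add: inj_on_nth)
    then have "orth_family {..<length ws} ((!) ws) \<longleftrightarrow> orth (set ws)"
      by (subst orth_family_reindex) (auto simp: set_conv_nth image_def intro!: arg_cong[of _ _ orth])
    then show ?thesis using orthogonal_iff_orth_family that by simp
  qed
  moreover have "set ws \<subseteq> V" if "span (set ws) = U"
    using that assms span_superset by blast
  moreover have "0 \<notin> set ws" if "independent (set ws)"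
    using that dependent_zero by blast
  ultimately show ?thesis
    unfolding orthogonal_basis_def using orth_independent orthD(3) by metis
qed

end

lemma nonarch_normed_subspace:
  assumes "nonarch_normed_space sc V l" "module.subspace sc U" "U \<subseteq> V"
  shows "nonarch_normed_space sc U l"
  using assms by (simp add: nonarch_normed_space_def subset_iff)

section \<open>Existence of singular value decompositions\<close>

locale nonarch_map = C: nonarch_space sC V lC + D: nonarch_space sD W lD
  for sC :: "('k::field, 'g::real_subgroup) novikov \<Rightarrow> 'v::ab_group_add \<Rightarrow> 'v" and V lC
    and sD :: "('k, 'g) novikov \<Rightarrow> 'w::ab_group_add \<Rightarrow> 'w" and W lD +
  fixes A :: "'v \<Rightarrow> 'w"
  assumes linear_A: "Vector_Spaces.linear sC sD A"
begin

sublocale A: Vector_Spaces.linear sC sD A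
  by (rule linear_A)

text \<open>No term of an orthogonal expansion exceeds the level of the vector, so an estimate on
  basis vectors passes to all combinations. In the elimination it shows that the gap of the pivot is
  minimal on the whole span, not only on the basis.\<close>

lemma bound_on_span:
  assumes B: "C.orth B" "A ` B \<subseteq> W" and bnd: "\<And>b. b \<in> B \<Longrightarrow> lD (A b) + ereal \<delta> \<le> lC b"
    and u: "u \<in> C.span B"
  shows "lD (A u) + ereal \<delta> \<le> lC u"
proof -
  obtain c where c: "u = (\<Sum>b\<in>B. sC (c b) b)" "\<And>b. b \<in> B \<Longrightarrow> lC (sC (c b) b) \<le> lC u"
    using C.orth_spanE[OF B(1) u] by blast
  have "lD (\<Sum>b\<in>B. sD (c b) (A b)) \<le> lC u - ereal \<delta>"
  proof (rule D.l_sum_le)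
    fix b assume b: "b \<in> B"
    then show "sD (c b) (A b) \<in> W" using B(2) by (intro D.subspace_scale D.subspace_V) auto
    have "lD (sD (c b) (A b)) = lD (A b) - val (c b)" using b B(2) by (intro D.l_scale) auto
    also have "\<dots> \<le> lC b - ereal \<delta> - val (c b)"
      using bnd[OF b] by (intro ereal_minus_mono) (auto simp: ereal_le_minus)
    also have "\<dots> = lC b - val (c b) - ereal \<delta>"
      by (cases "lC b"; cases "val (c b)") auto
    also have "\<dots> = lC (sC (c b) b) - ereal \<delta>"
      using C.orthD(2)[OF B(1) b] by (simp add: C.l_scale)
    also have "\<dots> \<le> lC u - ereal \<delta>"
      using c(2)[OF b] by (intro ereal_minus_mono) auto
    finally show "lD (sD (c b) (A b)) \<le> lC u - ereal \<delta>" .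
  qed
  also have "(\<Sum>b\<in>B. sD (c b) (A b)) = A u"
    by (simp add: c(1) A.sum A.scale)
  finally show ?thesis by (simp add: ereal_le_minus)
qed

text \<open>In the elimination step the pivot \<open>v\<close> maximises \<open>lD (A b) - lC b\<close> over the basis, so
  clearing the \<open>A v\<close>-component of the other basis vectors preserves orthogonality.\<close>

lemma svd_exists_sets:
  assumes "C.orth B" "D.orth E" "A ` B \<subseteq> D.span E"
  shows "\<exists>ys zs ws. distinct (ys @ zs) \<and> C.orth (set (ys @ zs)) \<and> C.span (set (ys @ zs)) = C.span B \<and>
    distinct (map A ys @ ws) \<and> D.orth (set (map A ys @ ws)) \<and>
    D.span (set (map A ys @ ws)) = D.span E \<and> (\<forall>z\<in>set zs. A z = 0) \<and>
    sorted_wrt (\<lambda>y y'. lC y' - lD (A y') \<le> lC y - lD (A y)) ys"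
  using assms
proof (induction "card B" arbitrary: B E rule: less_induct)
  case (less B E)
  note B = less.prems(1) and E = less.prems(2)
  note fin = C.orthD(1)[OF B] D.orthD(1)[OF E]
  note EW = D.orth_span_V[OF E]
  have AW: "A b \<in> W" if "b \<in> C.span B" for b
  proof -
    have "A b \<in> A ` C.span B" using that by blast
    also have "\<dots> = D.span (A ` B)" by (rule A.span_image[symmetric])
    also have "\<dots> \<subseteq> D.span E" using less.prems(3) by (intro D.span_minimal D.subspace_span)
    finally show ?thesis using EW by blast
  qed
  show ?case
  proof (cases "\<forall>b\<in>B. A b = 0")
    case True
    obtain zs ws where "distinct zs" "set zs = B" "distinct ws" "set ws = E"
      using fin finite_distinct_list by metis
    then show ?thesis using True B E by (intro exI[of _ "[]"] exI[of _ zs] exI[of _ ws]) auto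
  next
    case False
    \<comment> \<open>Vectors with nonzero image have real levels on both sides, which allows the
      pivot to be chosen by minimising a real number.\<close>
    define S where "S = {b \<in> B. A b \<noteq> 0}"
    define h where "h b = real_of_ereal (lC b) - real_of_ereal (lD (A b))" for b
    have "finite S" "S \<noteq> {}" using fin False by (auto simp: S_def)
    then obtain v where vS: "v \<in> S" and vmin: "\<And>b. b \<in> S \<Longrightarrow> h v \<le> h b"
      using arg_min_if_finite(1)[of S h] arg_min_least[of S _ h] by blast
    define x where "x = A v"
    define \<delta> where "\<delta> = h v"
    have v: "v \<in> B" "x \<noteq> 0" "v \<in> V" "v \<noteq> 0" using vS C.orthD[OF B] by (auto simp: S_def x_def)
    have xE: "x \<in> D.span E" using v(1) less.prems(3) by (auto simp: x_def)
    have xW: "x \<in> W" using xE EW by blast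
    have lvx: "lC v = lD x + ereal \<delta>"
      using C.l_real[OF v(3,4)] D.l_real[OF xW v(2)]
      by (cases "lC v"; cases "lD x") (auto simp: \<delta>_def h_def x_def)
    have bnd: "lD (A b) + ereal \<delta> \<le> lC b" if b: "b \<in> B" for b
    proof (cases "A b = 0")
      case False
      then have "h v \<le> h b" using b by (intro vmin) (simp add: S_def)
      moreover have "b \<in> V" "b \<noteq> 0" "A b \<in> W"
        using C.orthD[OF B] b AW[of b] C.span_base by auto
      ultimately show ?thesis
        using C.l_real[of b] D.l_real[of "A b"] False
        by (cases "lC b"; cases "lD (A b)") (auto simp: \<delta>_def h_def)
    qed simp
    have bnd': "lD (A u) + ereal \<delta> \<le> lC u" if "u \<in> C.span B" for u
      using B _ bnd that by (rule bound_on_span) (use AW C.span_base in auto)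
    obtain c where c: "x = (\<Sum>e\<in>E. sD (c e) e)" "\<And>e. e \<in> E \<Longrightarrow> lD (sD (c e) e) \<le> lD x"
      using D.orth_spanE[OF E xE] by blast
    \<comment> \<open>Some term reaches the level of \<open>x\<close>: if all were strictly lower,
      so would be their sum \<open>x\<close>. This \<open>j\<close> is the vector that
      \<open>x\<close> replaces.\<close>
    have "\<exists>j\<in>E. lD (sD (c j) j) = lD x"
    proof (rule ccontr)
      assume "\<not> ?thesis"
      then have "\<And>e. e \<in> E \<Longrightarrow> lD (sD (c e) e) < lD x" using c(2) by (simp add: order.not_eq_order_implies_strict)
      then have "lD (\<Sum>e\<in>E. sD (c e) e) < lD x"
        using fin xW v(2) D.orthD(2)[OF E] D.l_eq_MInf_iff
        by (intro D.l_sum_less D.subspace_scale D.subspace_V) auto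
      then show False using c(1) by simp
    qed
    then obtain j where j: "j \<in> E" "lD (sD (c j) j) = lD x" by blast
    define E1 where "E1 = E - {j}"
    have E1: "D.orth (insert x E1)" "x \<notin> E1" "D.span (insert x E1) = D.span E"
      unfolding E1_def using D.orth_exchange[OF E c(1) j v(2)] by simp_all
    have orthE1: "D.orth E1" using E by (rule D.orth_subset) (auto simp: E1_def)
    define B1 where "B1 = B - {v}"
    have B1: "insert v B1 = B" "v \<notin> B1" using v by (auto simp: B1_def)
    \<comment> \<open>\<open>a b\<close> is the coordinate of \<open>A b\<close> along
      \<open>x\<close> in the exchanged basis.\<close>
    have "\<exists>a. A b - sD a x \<in> D.span E1" if "b \<in> B1" for b
      using that less.prems(3) B1 D.span_breakdown_eq[of "A b" x E1] E1(3) by auto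
    then obtain a where a: "\<And>b. b \<in> B1 \<Longrightarrow> A b - sD (a b) x \<in> D.span E1" by metis
    define f where "f b = b - sC (a b) v" for b
    \<comment> \<open>The choice of the pivot enters here: orthogonality gives
      \<open>lD (sD (a b) x) \<le> lD (A b)\<close>, and adding \<open>\<delta>\<close> turns the
      left side into the level of \<open>sC (a b) v\<close> and keeps the right side below
      \<open>lC b\<close>.\<close>
    have la: "lC (sC (a b) v) \<le> lC b" if b: "b \<in> B1" for b
    proof -
      obtain e where e: "A b - sD (a b) x = (\<Sum>i\<in>E1. sD (e i) i)"
        using D.orth_spanE[OF orthE1 a[OF b]] by blast
      let ?e = "e(x := a b)"
      have "A b = sD (a b) x + (\<Sum>i\<in>E1. sD (e i) i)" using e by (simp add: algebra_simps)
      also have "(\<Sum>i\<in>E1. sD (e i) i) = (\<Sum>i\<in>E1. sD (?e i) i)"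
        using E1(2) by (intro sum.cong) auto
      finally have "A b = (\<Sum>i\<in>insert x E1. sD (?e i) i)"
        using E1(2) fin by (simp add: E1_def)
      then have le: "lD (sD (a b) x) \<le> lD (A b)"
        using D.orthD(4)[OF E1(1), of x ?e] by simp
      have "lC (sC (a b) v) = lD (sD (a b) x) + ereal \<delta>"
        unfolding C.l_scale[OF v(3)] D.l_scale[OF xW] lvx
        by (cases "lD x"; cases "val (a b)") auto
      also have "\<dots> \<le> lD (A b) + ereal \<delta>" using le by (rule add_right_mono)
      also have "\<dots> \<le> lC b" using b B1 by (intro bnd) auto
      finally show ?thesis .
    qed
    note sh = C.orth_shear[of v B1 a, folded f_def, unfolded B1(1), OF B B1(2) la]
    let ?B' = "f ` B1"
    have "card ?B' < card B"
      using fin v(1) card_image_le[of B1 f] card_Diff1_less[of B v] by (simp add: B1_def)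
    moreover have orthB': "C.orth ?B'" using sh(1) by (rule C.orth_subset) auto
    moreover have "A ` ?B' \<subseteq> D.span E1"
      using a by (auto simp: f_def A.diff A.scale x_def)
    ultimately obtain ys zs ws where
      y: "distinct (ys @ zs)" "C.orth (set (ys @ zs))" "C.span (set (ys @ zs)) = C.span ?B'" and
      w: "distinct (map A ys @ ws)" "D.orth (set (map A ys @ ws))"
        "D.span (set (map A ys @ ws)) = D.span E1" and
      z: "\<forall>z\<in>set zs. A z = 0" and
      sorted: "sorted_wrt (\<lambda>y y'. lC y' - lD (A y') \<le> lC y - lD (A y)) ys"
      using less.hyps[of ?B' E1] orthE1 by blast
    have disj: "{v} \<inter> ?B' = {}" "{x} \<inter> E1 = {}" using sh(3) E1(2) by auto
    \<comment> \<open>The recursion returns other orthogonal bases of the spans of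
      \<open>?B'\<close> and \<open>E1\<close>; \<open>v\<close> and \<open>x\<close> remain
      orthogonal to them.\<close>
    note ry = C.orth_replace[of "{v}" ?B' "set (ys @ zs)", simplified, OF sh(1,3) y(2,3)[simplified]]
    note rw = D.orth_replace[of "{x}" E1 "set (map A ys @ ws)", simplified, OF E1(1,2) w(2,3)[simplified]]
    have yB: "y \<in> C.span B" if "y \<in> set ys" for y
    proof -
      have "y \<in> C.span ?B'" using that y(3) C.span_base[of y "set (ys @ zs)"] by simp
      also have "\<dots> \<subseteq> C.span (insert v ?B')" by (intro C.span_mono) auto
      finally show ?thesis using sh(4) by simp
    qed
    \<comment> \<open>All vectors found by the recursion lie in the span of \<open>B\<close>, where
      no gap is below \<open>\<delta>\<close>; in decreasing order the pivot therefore goes to the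
      end.\<close>
    have last: "lC v - lD (A v) \<le> lC y - lD (A y)" if "y \<in> set ys" for y
    proof -
      have "A y \<noteq> 0" using D.orthD(3)[OF w(2)] that by auto
      moreover have "A y \<in> W" "y \<in> V" "y \<noteq> 0"
        using AW[OF yB[OF that]] C.orthD(2,3)[OF y(2), of y] that by auto
      ultimately show ?thesis
        using D.l_real[of "A y"] C.l_real[of y] D.l_real[OF xW v(2)] lvx bnd'[OF yB[OF that]]
        by (cases "lC y"; cases "lD (A y)"; cases "lD x") (auto simp: x_def)
    qed
    show ?thesis
    proof (intro exI conjI)
      show "distinct ((ys @ [v]) @ zs)" using y(1) ry(2) by auto
      show "C.orth (set ((ys @ [v]) @ zs))" using ry(1) by simp
      show "C.span (set ((ys @ [v]) @ zs)) = C.span B" using ry(3) sh(4) by simp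
      show "distinct (map A (ys @ [v]) @ ws)" using w(1) rw(2) by (auto simp: x_def)
      show "D.orth (set (map A (ys @ [v]) @ ws))" using rw(1) by (simp add: x_def)
      show "D.span (set (map A (ys @ [v]) @ ws)) = D.span E" using rw(3) E1(3) by (simp add: x_def)
      show "\<forall>z\<in>set zs. A z = 0" by (rule z)
      show "sorted_wrt (\<lambda>y y'. lC y' - lD (A y') \<le> lC y - lD (A y)) (ys @ [v])"
        using sorted last by (simp add: sorted_wrt_append)
    qed
  qed
qed

text \<open>Rank, image and kernel are read off from \<open>svd_exists_sets\<close>: the vectors
  \<open>A y\<close> are orthogonal, hence independent, so a kernel element has no component along
  \<open>ys\<close>.\<close>

lemma svd_exists:
  assumes "\<exists>bs. orthogonal_basis sC lC V bs" "\<exists>es. orthogonal_basis sD lD W es" "A ` V \<subseteq> W"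
  shows "\<exists>ys xs. singular_value_decomposition sC V lC sD W lD A ys xs"
proof -
  obtain bs es where B: "C.orth (set bs)" "C.span (set bs) = V"
    and E: "D.orth (set es)" "D.span (set es) = W"
    using assms(1,2) by (auto simp: C.orthogonal_basis_iff D.orthogonal_basis_iff)
  have "A ` set bs \<subseteq> D.span (set es)" using assms(3) B(2) E(2) C.span_superset by auto
  from svd_exists_sets[OF B(1) E(1) this] obtain ys zs ws where
    y: "distinct (ys @ zs)" "C.orth (set (ys @ zs))" "C.span (set (ys @ zs)) = V" and
    w: "distinct (map A ys @ ws)" "D.orth (set (map A ys @ ws))"
      "D.span (set (map A ys @ ws)) = W" and
    z: "\<forall>z\<in>set zs. A z = 0" and
    sorted: "sorted_wrt (\<lambda>y y'. lC y' - lD (A y') \<le> lC y - lD (A y)) ys"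
    unfolding B(2) E(2) by blast
  have oA: "D.orth (A ` set ys)" using w(2) by (rule D.orth_subset) auto
  have oz: "C.orth (set zs)" using y(2) by (rule C.orth_subset) auto
  have inj: "inj_on A (set ys)" using w(1) by (simp add: distinct_map)
  have "A ` V = D.span (A ` (set ys \<union> set zs))"
    using y(3) A.span_image[of "set (ys @ zs)"] by simp
  also have "\<dots> = D.span (A ` set ys)"
  proof (rule D.span_eq[THEN iffD2], intro conjI)
    show "A ` (set ys \<union> set zs) \<subseteq> D.span (A ` set ys)"
      using z D.span_zero D.span_superset by (auto intro: D.span_base)
    show "A ` set ys \<subseteq> D.span (A ` (set ys \<union> set zs))"
      by (auto intro: D.span_base)
  qed
  finally have im: "A ` V = D.span (A ` set ys)" .
  have r: "D.dim (A ` V) = length ys"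
    unfolding im using D.dim_span_eq_card_independent[OF D.orth_independent[OF oA]] inj y(1)
    by (simp add: card_image distinct_card)
  have ker: "{u \<in> V. A u = 0} = C.span (set zs)"
  proof
    show "C.span (set zs) \<subseteq> {u \<in> V. A u = 0}"
    proof
      fix u assume u: "u \<in> C.span (set zs)"
      then have "u \<in> V" using C.orth_span_V[OF oz] by blast
      moreover have "A u = 0" using u z by (induction rule: C.span_induct_alt) (auto simp: A.add A.scale A.zero)
      ultimately show "u \<in> {u \<in> V. A u = 0}" by simp
    qed
    show "{u \<in> V. A u = 0} \<subseteq> C.span (set zs)"
    proof
      fix u assume u: "u \<in> {u \<in> V. A u = 0}"
      then have "u \<in> C.span (set ys \<union> set zs)" using y(3) by simp
      then obtain c where c: "u = (\<Sum>b\<in>set ys \<union> set zs. sC (c b) b)"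
        by (subst (asm) C.span_finite) auto
      then have us: "u = (\<Sum>b\<in>set ys. sC (c b) b) + (\<Sum>b\<in>set zs. sC (c b) b)"
        using y(1) by (simp add: sum.union_disjoint)
      have zz: "(\<Sum>b\<in>set zs. sD (c b) (A b)) = 0" using z by simp
      have fam: "D.orth_family (set ys) A" using D.orth_family_reindex[OF inj] oA by simp
      have "(\<Sum>b\<in>set ys. sD (c b) (A b)) = 0"
        using u us zz by (simp add: A.add A.sum A.scale)
      then have "c b = 0" if "b \<in> set ys" for b using D.orth_family_coeff_eq_0[OF fam _ that] by blast
      then have "u = (\<Sum>b\<in>set zs. sC (c b) b)" using us by simp
      then show "u \<in> C.span (set zs)" by (auto intro: C.span_sum C.span_scale C.span_base)
    qed
  qed
  have kerV: "{u \<in> V. A u = 0} \<subseteq> V" by auto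
  show ?thesis
  proof (intro exI[of _ "ys @ zs"] exI[of _ "map A ys @ ws"])
    show "singular_value_decomposition sC V lC sD W lD A (ys @ zs) (map A ys @ ws)"
      unfolding singular_value_decomposition_def Let_def r C.orthogonal_basis_iff[OF order_refl]
        D.orthogonal_basis_iff[OF order_refl] C.orthogonal_basis_iff[OF kerV]
        D.orthogonal_basis_iff[OF assms(3)]
    proof (intro conjI allI impI; (elim conjE)?)
      fix i j assume "i \<le> j" "j < length ys"
      then show "lC ((ys @ zs) ! j) - lD ((map A ys @ ws) ! j)
          \<le> lC ((ys @ zs) ! i) - lD ((map A ys @ ws) ! i)"
        using sorted_wrt_nth_less[OF sorted, of i j] by (cases "i = j") (auto simp: nth_append)
    qed (use y w ker im oA oz in \<open>auto simp: nth_append\<close>)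
  qed
qed

end

section \<open>Bases adapted to the boundary operator\<close>

text \<open>\<open>R\<close> contains the cycles that bound and \<open>p\<close> selects the chain
  that a bar pairs with such a cycle. Bars are thus indexed by vectors instead of list
  positions.\<close>

definition bar_length :: "('v \<Rightarrow> ereal) \<Rightarrow> 'v set \<Rightarrow> ('v \<Rightarrow> 'v) \<Rightarrow> 'v \<Rightarrow> ereal" where
  "bar_length l R p x = (if x \<in> R then l (p x) - l x else \<infinity>)"

locale floer_complex =
  fixes C :: "(('k::field, 'g::real_subgroup) novikov, 'v::ab_group_add) filtered_complex"
  assumes floer: "floer_type_complex C"
begin

sublocale vector_space "scl C"
  using floer by (simp add: floer_type_complex_def)

sublocale d: Vector_Spaces.linear "scl C" "scl C" "bd C"
  using floer by (simp add: floer_type_complex_def)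

sublocale N: nonarch_space "scl C" "grading C k" "filt C" for k
  by unfold_locales (use floer in \<open>simp add: floer_type_complex_def orthogonalizable_def\<close>)

lemma direct_sum: "direct_sum_decomposition (grading C)"
  and bd_grading: "x \<in> grading C k \<Longrightarrow> bd C x \<in> grading C (k - 1)"
  and bd_bd [simp]: "bd C (bd C x) = 0"
  and filt_bd: "x \<in> grading C k \<Longrightarrow> filt C (bd C x) \<le> filt C x"
  and ex_orthogonal_basis: "\<exists>ws. orthogonal_basis (scl C) (filt C) (grading C k) ws"
  using floer by (auto simp: floer_type_complex_def orthogonalizable_def image_subset_iff)

lemma bd_grading_Suc: "x \<in> grading C (k + 1) \<Longrightarrow> bd C x \<in> cycles C k"
  using bd_grading[of x "k + 1"] by (simp add: cycles_def)

lemma cycles_subset: "cycles C k \<subseteq> grading C k"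
  by (auto simp: cycles_def)

lemma subspace_cycles: "subspace (cycles C k)"
  using N.subspace_V[of k]
  by (auto simp: cycles_def subspace_def d.add d.scale)

lemma nonarch_space_cycles: "nonarch_space (scl C) (cycles C k) (filt C)"
  by unfold_locales (rule nonarch_normed_subspace[OF N.normed subspace_cycles cycles_subset])

text \<open>A singular value decomposition of the boundary operator between the full chain spaces
  contains an orthogonal basis of its kernel. This supplies the target basis needed for a
  decomposition into the cycles.\<close>

lemma ex_orthogonal_basis_cycles: "\<exists>ws. orthogonal_basis (scl C) (filt C) (cycles C k) ws"
proof -
  interpret nonarch_map "scl C" "grading C k" "filt C" "scl C" "grading C (k - 1)" "filt C" "bd C"
    by unfold_locales
  have "bd C ` grading C k \<subseteq> grading C (k - 1)" using bd_grading by blast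
  from svd_exists[OF ex_orthogonal_basis ex_orthogonal_basis this] show ?thesis
    unfolding singular_value_decomposition_def Let_def cycles_def by blast
qed

lemma ex_boundary_svd: "\<exists>ys xs. boundary_svd C k ys xs"
proof -
  interpret Z: nonarch_space "scl C" "cycles C k" "filt C"
    by (rule nonarch_space_cycles)
  interpret nonarch_map "scl C" "grading C (k + 1)" "filt C" "scl C" "cycles C k" "filt C" "bd C"
    by unfold_locales
  have "bd C ` grading C (k + 1) \<subseteq> cycles C k" using bd_grading_Suc by blast
  from svd_exists[OF ex_orthogonal_basis ex_orthogonal_basis_cycles this] show ?thesis
    by (simp add: boundary_svd_def)
qed

text \<open>The clause on all \<open>Z\<close> leaves the kernel part of the basis of degree
  \<open>k + 1\<close> open, so that the cycle basis from the next decomposition can be inserted;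
  \<open>orth_replace\<close> permits this.\<close>

lemma boundary_svd_bars:
  assumes "boundary_svd C k ys xs"
  shows "\<exists>X R p. N.orth k X \<and> span X = cycles C k \<and> R \<subseteq> X \<and>
    (\<forall>x\<in>R. p x \<in> grading C (k + 1) \<and> bd C (p x) = x) \<and>
    (\<forall>Z. N.orth (k + 1) Z \<and> span Z = cycles C (k + 1) \<longrightarrow>
       N.orth (k + 1) (p ` R \<union> Z) \<and> span (p ` R \<union> Z) = grading C (k + 1)) \<and>
    svd_barcode C k ys xs = image_mset (\<lambda>x. (residue_class TYPE('g) (real_of_ereal (filt C x)),
       bar_length (filt C) R p x)) (mset_set X)"
proof -
  define r where "r = dim (bd C ` grading C (k + 1))"
  have im: "bd C ` grading C (k + 1) \<subseteq> cycles C k" using bd_grading_Suc by blast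
  have ker: "{v \<in> grading C (k + 1). bd C v = 0} = cycles C (k + 1)" by (simp add: cycles_def)
  have ys: "distinct ys" "N.orth (k + 1) (set ys)" "span (set ys) = grading C (k + 1)"
    and xs: "distinct xs" "N.orth k (set xs)" "span (set xs) = cycles C k"
    and dr: "N.orth (k + 1) (set (drop r ys))" "span (set (drop r ys)) = cycles C (k + 1)"
    and tk: "N.orth k (set (take r xs))" "span (set (take r xs)) = bd C ` grading C (k + 1)"
    and eq: "\<And>i. i < r \<Longrightarrow> bd C (ys ! i) = xs ! i"
    using assms unfolding boundary_svd_def singular_value_decomposition_def Let_def r_def[symmetric] ker
      N.orthogonal_basis_iff[OF order_refl] N.orthogonal_basis_iff[OF cycles_subset]
      N.orthogonal_basis_iff[OF subset_trans[OF im cycles_subset]] by blast+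
  have "r = card (set (take r xs))"
    using dim_span_eq_card_independent[OF N.orth_independent[OF tk(1)]]
    unfolding tk(2) r_def[symmetric] .
  then have rx: "r \<le> length xs"
    using xs(1) by (simp add: distinct_card)
  have "r \<le> card (bd C ` set ys)"
    unfolding r_def by (rule dim_le_card) (use d.span_image[of "set ys"] ys(3) in auto)
  also have "\<dots> \<le> length ys" by (meson List.finite_set card_image_le card_length le_trans)
  finally have ry: "r \<le> length ys" .
  have inj: "inj_on ((!) xs) {..<r}" using xs(1) rx by (simp add: inj_on_nth)
  define R where "R = (!) xs ` {..<r}"
  define p where "p x = ys ! the_inv_into {..<r} ((!) xs) x" for x
  have p: "p (xs ! i) = ys ! i" if "i < r" for i
    using that by (simp add: p_def the_inv_into_f_f[OF inj])
  have pR: "p ` R = set (take r ys)"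
  proof -
    have "p ` R = (\<lambda>i. ys ! i) ` {..<r}"
      unfolding R_def image_image by (rule image_cong) (simp_all add: p)
    then show ?thesis using ry by (simp add: nth_image lessThan_atLeast0)
  qed
  have Y: "set (take r ys) \<union> set (drop r ys) = set ys"
    by (metis append_take_drop_id set_append)
  have disj: "set (take r ys) \<inter> set (drop r ys) = {}"
    using ys(1) by (rule set_take_disj_set_drop_if_distinct) simp
  have mem: "xs ! i \<in> R \<longleftrightarrow> i < r" if "i < length xs" for i
    using that rx xs(1) by (auto simp: R_def nth_eq_iff_index_eq)
  show ?thesis
  proof (rule exI[of _ "set xs"], rule exI[of _ R], rule exI[of _ p], intro conjI ballI allI impI; (elim conjE)?)
    show "N.orth k (set xs)" "span (set xs) = cycles C k" by (fact xs)+
    show "R \<subseteq> set xs" using rx by (auto simp: R_def)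
    fix x assume "x \<in> R"
    then obtain i where i: "i < r" "x = xs ! i" by (auto simp: R_def)
    then show "bd C (p x) = x" using eq p by simp
    have "ys ! i \<in> set ys" using i ry by simp
    then have "ys ! i \<in> grading C (k + 1)" using N.orthD(2)[OF ys(2)] by blast
    then show "p x \<in> grading C (k + 1)" using i p by simp
  next
    fix Z assume Z: "N.orth (k + 1) Z" "span Z = cycles C (k + 1)"
    note rep = N.orth_replace[of "k + 1" "set (take r ys)" "set (drop r ys)" Z, unfolded Y, OF ys(2) disj Z(1)]
    show "N.orth (k + 1) (p ` R \<union> Z)" "span (p ` R \<union> Z) = grading C (k + 1)"
      unfolding pR using rep Z(2) dr(2) ys(3) by simp_all
  next
    have "mset_set (set xs) = image_mset ((!) xs) (mset [0..<length xs])"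
      using xs(1) by (metis map_nth mset_map mset_set_set)
    then show "svd_barcode C k ys xs = image_mset (\<lambda>x. (residue_class TYPE('g) (real_of_ereal (filt C x)),
        bar_length (filt C) R p x)) (mset_set (set xs))"
      by (auto simp: svd_barcode_def r_def[symmetric] multiset.map_comp bar_length_def mem p
          intro!: image_mset_cong)
  qed
qed

end

text \<open>\<open>X k\<close> is the basis \<open>x\<^sub>1, \<dots>, x\<^sub>m\<close> of a singular value decomposition of the boundary operator
  into the \<open>k\<close>-cycles, \<open>R k\<close> consists of \<open>x\<^sub>1, \<dots>, x\<^sub>r\<close>, and \<open>p k\<close> is \<open>x\<^sub>i \<mapsto> y\<^sub>i\<close>. The remaining
  \<open>y\<^sub>i\<close> are replaced by \<open>X (k + 1)\<close>, so that each degree has one basis serving two consecutive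
  decompositions.\<close>

locale floer_bars = floer_complex C
  for C :: "(('k::field, 'g::real_subgroup) novikov, 'v::ab_group_add) filtered_complex" +
  fixes X R :: "int \<Rightarrow> 'v set" and p :: "int \<Rightarrow> 'v \<Rightarrow> 'v"
  assumes orth_X: "N.orth k (X k)" and span_X: "span (X k) = cycles C k"
    and R_subset: "R k \<subseteq> X k"
    and p_grading: "x \<in> R k \<Longrightarrow> p k x \<in> grading C (k + 1)" and bd_p: "x \<in> R k \<Longrightarrow> bd C (p k x) = x"
    and orth_basis: "N.orth (k + 1) (p k ` R k \<union> X (k + 1))"
    and span_basis: "span (p k ` R k \<union> X (k + 1)) = grading C (k + 1)"
    and concise_eq: "concise_barcode C k = image_mset
      (\<lambda>x. (residue_class TYPE('g) (real_of_ereal (filt C x)), bar_length (filt C) (R k) (p k) x))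
      (filter_mset (\<lambda>x. bar_length (filt C) (R k) (p k) x > 0) (mset_set (X k)))"

text \<open>In each degree the decomposition is the one that \<open>SOME\<close> selects in
  \<open>verbose_barcode\<close>, so \<open>concise_eq\<close> describes the defined barcode
  itself.\<close>

lemma (in floer_complex) ex_floer_bars: "\<exists>X R p. floer_bars C X R p"
proof -
  define Q where "Q k X R p \<longleftrightarrow> N.orth k X \<and> span X = cycles C k \<and> R \<subseteq> X \<and>
    (\<forall>x\<in>R. p x \<in> grading C (k + 1) \<and> bd C (p x) = x) \<and>
    (\<forall>Z. N.orth (k + 1) Z \<and> span Z = cycles C (k + 1) \<longrightarrow>
       N.orth (k + 1) (p ` R \<union> Z) \<and> span (p ` R \<union> Z) = grading C (k + 1)) \<and>
    verbose_barcode C k = image_mset (\<lambda>x. (residue_class TYPE('g) (real_of_ereal (filt C x)),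
       bar_length (filt C) R p x)) (mset_set X)" for k X R p
  have "\<exists>X R p. Q k X R p" for k
  proof -
    obtain ys xs where ch: "(SOME (ys, xs). boundary_svd C k ys xs) = (ys, xs)" by fastforce
    have "case (SOME (ys, xs). boundary_svd C k ys xs) of (ys, xs) \<Rightarrow> boundary_svd C k ys xs"
      by (rule someI_ex) (use ex_boundary_svd in auto)
    then have "boundary_svd C k ys xs" unfolding ch by simp
    from boundary_svd_bars[OF this] show ?thesis
      unfolding Q_def verbose_barcode_def ch prod.case .
  qed
  then obtain X R p where "\<And>k. Q k (X k) (R k) (p k)" by metis
  note b = this[unfolded Q_def]
  have "floer_bars C X R p"
    unfolding floer_bars_def floer_bars_axioms_def
  proof (intro conjI allI impI)
    show "floer_complex C" by (rule floer_complex_axioms)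
    fix k
    show "concise_barcode C k = image_mset
      (\<lambda>x. (residue_class TYPE('g) (real_of_ereal (filt C x)), bar_length (filt C) (R k) (p k) x))
      (filter_mset (\<lambda>x. bar_length (filt C) (R k) (p k) x > 0) (mset_set (X k)))"
      using b[of k] by (simp add: concise_barcode_def filter_mset_image_mset)
    \<comment> \<open>The clause on arbitrary \<open>Z\<close> is applied to the cycle basis
      \<open>X (k + 1)\<close>.\<close>
    show "N.orth (k + 1) (p k ` R k \<union> X (k + 1))" "span (p k ` R k \<union> X (k + 1)) = grading C (k + 1)"
      using b[of k] b[of "k + 1"] by blast+
  qed (use b in blast)+
  then show ?thesis by blast
qed

section \<open>Counting bars\<close>

text \<open>Gaussian elimination: equation \<open>j\<close> is solved for an unknown
  \<open>h\<close> that occurs in it, and the remaining system has one unknown and one equation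
  less.\<close>

lemma homogeneous_system_nontrivial:
  fixes M :: "'i \<Rightarrow> 'j \<Rightarrow> 'k::field"
  assumes "finite J" "finite I" "card J < card I"
  shows "\<exists>c. (\<exists>i\<in>I. c i \<noteq> 0) \<and> (\<forall>j\<in>J. (\<Sum>i\<in>I. c i * M i j) = 0)"
  using assms
proof (induction J arbitrary: I M rule: finite_induct)
  case empty
  then obtain i where "i \<in> I" by fastforce
  then show ?case by (intro exI[of _ "\<lambda>_. 1"]) auto
next
  case (insert j J)
  show ?case
  proof (cases "\<forall>i\<in>I. M i j = 0")
    case True
    have "card J < card I" using insert by simp
    from insert.IH[OF insert.prems(1) this, of M] show ?thesis using True by auto
  next
    case False
    then obtain h where h: "h \<in> I" "M h j \<noteq> 0" by blast
    \<comment> \<open>The coefficients of the other equations after substituting for the unknown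
      \<open>h\<close>.\<close>
    define N where "N i j' = M i j' - M i j / M h j * M h j'" for i j'
    have "card J < card (I - {h})" using insert h by simp
    from insert.IH[OF _ this, of N] insert.prems(1) obtain c where
      c: "\<exists>i\<in>I - {h}. c i \<noteq> 0" "\<And>j. j \<in> J \<Longrightarrow> (\<Sum>i\<in>I - {h}. c i * N i j) = 0" by auto
    define c' where "c' = c(h := - (\<Sum>i\<in>I - {h}. c i * M i j) / M h j)"
    have split: "(\<Sum>i\<in>I. c' i * M i j') = c' h * M h j' + (\<Sum>i\<in>I - {h}. c i * M i j')" for j'
      using h(1) insert.prems(1) by (subst sum.remove[of _ h]) (auto simp: c'_def)
    have "(\<Sum>i\<in>I. c' i * M i j) = 0"
      unfolding split using h(2) by (simp add: c'_def)
    moreover have "(\<Sum>i\<in>I. c' i * M i j') = 0" if "j' \<in> J" for j'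
    proof -
      have "(\<Sum>i\<in>I - {h}. c i * M i j') =
          (\<Sum>i\<in>I - {h}. c i * N i j') + (\<Sum>i\<in>I - {h}. c i * M i j) / M h j * M h j'"
        unfolding sum_divide_distrib sum_distrib_right sum.distrib[symmetric]
        by (rule sum.cong) (simp_all add: N_def algebra_simps)
      then show ?thesis unfolding split using c(2)[OF that] by (simp add: c'_def)
    qed
    ultimately show ?thesis using c(1) by (intro exI[of _ c']) (auto simp: c'_def)
  qed
qed

text \<open>The multiplicity of \<open>(s, t)\<close> is the number of elements over
  \<open>s\<close> beyond a bound just below \<open>t\<close>, minus the number beyond
  \<open>t\<close>. Finiteness provides a real bound with no second coordinate strictly between it
  and \<open>t\<close>.\<close>

lemma mset_eq_by_tail_counts:
  fixes M N :: "('s \<times> ereal) multiset"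
  assumes pos: "\<And>q. q \<in># M \<Longrightarrow> snd q > 0" "\<And>q. q \<in># N \<Longrightarrow> snd q > 0"
    and tails: "\<And>s b. 0 \<le> b \<Longrightarrow> size {#q \<in># M. fst q = s \<and> ereal b < snd q#} =
      size {#q \<in># N. fst q = s \<and> ereal b < snd q#}"
  shows "M = N"
proof (rule multiset_eqI)
  fix q :: "'s \<times> ereal"
  obtain s t where q: "q = (s, t)" by force
  show "count M q = count N q"
  proof (cases "t > 0")
    case False
    then have "q \<notin># M" "q \<notin># N" using pos q by force+
    then show ?thesis by (simp add: not_in_iff)
  next
    case True
    \<comment> \<open>The element 0 keeps the bound nonnegative, as \<open>tails\<close>
      requires.\<close>
    define F where "F = insert 0 {u \<in> snd ` set_mset (M + N). u < t}"
    have F: "finite F" "F \<noteq> {}" by (auto simp: F_def)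
    have "Max F \<in> F" using F by (rule Max_in)
    then have "Max F < t" using True by (auto simp: F_def)
    moreover have "0 \<le> Max F" using F by (intro Max_ge) (auto simp: F_def)
    ultimately have "0 \<le> Max F" "Max F < t" by simp_all
    then obtain b where b: "Max F = ereal b" "0 \<le> b" "ereal b < t" by (cases "Max F") auto
    have gap: "u \<le> ereal b" if "u \<in> snd ` set_mset (M + N)" "u < t" for u
      using that F b(1) Max_ge[of F u] by (auto simp: F_def)
    have split: "{#q \<in># L. fst q = s \<and> ereal b < snd q#} =
        {#q \<in># L. fst q = s \<and> t < snd q#} + {#q' \<in># L. q' = q#}"
      if "L \<subseteq># M + N" for L
    proof -
      have "{#q \<in># L. fst q = s \<and> ereal b < snd q#} =
          {#q' \<in># L. (fst q' = s \<and> t < snd q') \<or> q' = q#}"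
      proof (rule filter_mset_cong[OF refl])
        fix q' assume "q' \<in># L"
        then have "snd q' \<in> snd ` set_mset (M + N)" using that by (metis image_eqI mset_subset_eqD)
        from gap[OF this] show "(fst q' = s \<and> ereal b < snd q') = (fst q' = s \<and> t < snd q' \<or> q' = q)"
          using b(3) unfolding q by (cases q'; cases "snd q'" t rule: linorder_cases) (auto simp: not_less)
      qed
      also have "\<dots> = {#q \<in># L. fst q = s \<and> t < snd q#} + {#q' \<in># L. q' = q#}"
        by (rule multiset_eqI) (auto simp: q)
      finally show ?thesis .
    qed
    \<comment> \<open>For \<open>t = \<infinity>\<close>, where \<open>tails\<close> does not apply,
      both sides are empty.\<close>
    have "size {#q \<in># M. fst q = s \<and> t < snd q#} = size {#q \<in># N. fst q = s \<and> t < snd q#}"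
      using tails[of "real_of_ereal t" s] True by (cases t) auto
    moreover have "size {#q' \<in># L. q' = q#} = count L q" for L
      by (simp add: filter_eq_replicate_mset)
    moreover note tails[OF b(2), of s] split[of M] split[of N]
    ultimately show ?thesis by simp
  qed
qed

lemma residue_class_eq_iff:
  "residue_class TYPE('g::real_subgroup) a = residue_class TYPE('g) b \<longleftrightarrow> (\<exists>g::'g. a = b + to_real g)"
proof
  assume "residue_class TYPE('g) a = residue_class TYPE('g) b"
  moreover have "a \<in> residue_class TYPE('g) a"
    unfolding residue_class_def by (rule image_eqI[of _ _ 0]) auto
  ultimately show "\<exists>g::'g. a = b + to_real g" by (auto simp: residue_class_def)
next
  assume "\<exists>g::'g. a = b + to_real g"
  then obtain g :: 'g where g: "a = b + to_real g" ..
  have "a + to_real h = b + to_real (g + h)" "b + to_real h = a + to_real (h - g)" for h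
    by (simp_all add: g to_real_add to_real_diff)
  then show "residue_class TYPE('g) a = residue_class TYPE('g) b"
    unfolding residue_class_def image_def by (intro set_eqI iffI; elim CollectE bexE; blast)
qed

section \<open>Long bars as coordinates on cycles modulo fillable ones\<close>

context floer_bars
begin

abbreviation len :: "int \<Rightarrow> 'v \<Rightarrow> ereal" where
  "len k \<equiv> bar_length (filt C) (R k) (p k)"

lemma finite_X: "finite (X k)"
  by (rule N.orthD(1)[OF orth_X])

lemma X_cycles: "x \<in> X k \<Longrightarrow> x \<in> cycles C k"
  using span_base span_X by blast

lemma X_grading: "x \<in> X k \<Longrightarrow> x \<in> grading C k" and bd_X: "x \<in> X k \<Longrightarrow> bd C x = 0"
  using X_cycles by (auto simp: cycles_def)

lemma X_nonzero: "x \<in> X k \<Longrightarrow> x \<noteq> 0"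
  by (rule N.orthD(3)[OF orth_X])

lemma filt_X: "x \<in> X k \<Longrightarrow> filt C x = ereal (real_of_ereal (filt C x))"
  by (rule N.l_real[OF X_grading X_nonzero])

lemma p_nonzero: "x \<in> R k \<Longrightarrow> p k x \<noteq> 0"
  using bd_p[of x k] R_subset X_nonzero d.zero by force

lemma filt_p: "x \<in> R k \<Longrightarrow> filt C (p k x) = ereal (real_of_ereal (filt C (p k x)))"
  by (rule N.l_real[OF p_grading p_nonzero])

lemma inj_on_p: "inj_on (p k) (R k)"
  by (rule inj_on_inverseI[of _ "bd C"]) (rule bd_p)

lemma p_disjoint: "p k ` R k \<inter> X j = {}"
  using bd_X bd_p R_subset X_nonzero by force

lemma filt_p_eq: "x \<in> R k \<Longrightarrow> filt C (p k x) = filt C x + len k x"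
  using filt_p[of x k] filt_X[of x k] R_subset[of k]
  by (cases "filt C x"; cases "filt C (p k x)") (auto simp: bar_length_def)

lemma len_nonneg: "x \<in> X k \<Longrightarrow> 0 \<le> len k x"
  using filt_bd[OF p_grading, of x k] filt_X[of x k]
  by (cases "filt C x"; cases "filt C (p k x)") (auto simp: bar_length_def bd_p)

text \<open>In the adapted basis of degree \<open>k + 1\<close> the boundary kills
  \<open>X (k + 1)\<close> and sends \<open>p k x\<close> to \<open>x\<close>, so the coefficient of
  \<open>y\<close> at \<open>p k x\<close> must be \<open>c x\<close>. Orthogonality then shows that
  no filling is cheaper than the one by the vectors \<open>p k x\<close>.\<close>

lemma filling_coeff:
  assumes y: "y \<in> grading C (k + 1)" "bd C y = (\<Sum>x\<in>X k. scl C (c x) x)"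
    and x: "x \<in> X k" "c x \<noteq> 0"
  shows "x \<in> R k" "filt C (scl C (c x) (p k x)) \<le> filt C y"
proof -
  have "y \<in> span (p k ` R k \<union> X (k + 1))" using y(1) span_basis by simp
  then obtain e where e: "y = (\<Sum>b\<in>p k ` R k \<union> X (k + 1). scl C (e b) b)"
    "\<And>b. b \<in> p k ` R k \<union> X (k + 1) \<Longrightarrow> filt C (scl C (e b) b) \<le> filt C y"
    using N.orth_spanE[OF orth_basis] by blast
  have finR: "finite (R k)" using finite_X R_subset by (rule finite_subset[rotated])
  have "bd C y = (\<Sum>b\<in>p k ` R k. scl C (e b) (bd C b)) + (\<Sum>b\<in>X (k + 1). scl C (e b) (bd C b))"
    unfolding e(1) using finR finite_X p_disjoint
    by (subst sum.union_disjoint) (auto simp: d.add d.sum d.scale)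
  also have "(\<Sum>b\<in>X (k + 1). scl C (e b) (bd C b)) = 0" by (simp add: bd_X)
  also have "(\<Sum>b\<in>p k ` R k. scl C (e b) (bd C b)) = (\<Sum>x\<in>R k. scl C (e (p k x)) x)"
    by (simp add: sum.reindex[OF inj_on_p] bd_p)
  also have "\<dots> = (\<Sum>x\<in>X k. scl C (if x \<in> R k then e (p k x) else 0) x)"
    using finite_X R_subset by (intro sum.mono_neutral_cong_left) auto
  finally have "(\<Sum>x\<in>X k. scl C (c x - (if x \<in> R k then e (p k x) else 0)) x) = 0"
    by (simp add: y(2) scale_left_diff_distrib sum_subtractf)
  from N.orth_family_coeff_eq_0[OF orth_X[unfolded N.orth_def] this x(1)]
  have cx: "c x = (if x \<in> R k then e (p k x) else 0)" by simp
  then show R: "x \<in> R k" using x(2) by (auto split: if_splits)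
  show "filt C (scl C (c x) (p k x)) \<le> filt C y" using e(2)[of "p k x"] R cx by simp
qed

text \<open>The terms of level exactly \<open>a\<close> can only belong to bars of length at most
  \<open>b\<close>; each is the boundary of the same multiple of \<open>p k x\<close>, whose level
  is \<open>a\<close> plus the length. All other terms lie strictly below \<open>a\<close>.\<close>

lemma cycle_decomposition:
  assumes z: "z = (\<Sum>x\<in>X k. scl C (c x) x)" "filt C z \<le> ereal a" and b: "0 \<le> b"
    and c: "\<And>x g. x \<in> X k \<Longrightarrow> ereal b < len k x \<Longrightarrow> real_of_ereal (filt C x) = a + to_real g \<Longrightarrow>
      coeff (c x) g = 0"
  obtains z' y where "z = z' + bd C y" "z' \<in> cycles C k" "filt C z' < ereal a"
    "y \<in> grading C (k + 1)" "filt C y \<le> ereal (a + b)"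
proof -
  define S where "S = {x \<in> X k. filt C (scl C (c x) x) = ereal a}"
  have le: "filt C (scl C (c x) x) \<le> ereal a" if "x \<in> X k" for x
    using N.orthD(4)[OF orth_X that, of c] z by simp
  have S: "x \<in> R k \<and> filt C (scl C (c x) (p k x)) \<le> ereal (a + b)" if x: "x \<in> S" for x
  proof -
    have xX: "x \<in> X k" and ax: "filt C x - val (c x) = ereal a"
      using x N.l_scale[OF X_grading, of x k "c x"] by (auto simp: S_def)
    \<comment> \<open>The level is finite, so the valuation is attained at some \<open>g\<close>,
      and \<open>\<ell>(x) = a + g\<close>. The hypothesis \<open>c\<close> then rules out a length
      above \<open>b\<close>; in particular the bar is finite.\<close>
    have "c x \<noteq> 0" using ax by (cases "filt C x") auto
    then obtain g where g: "coeff (c x) g \<noteq> 0" "val (c x) = ereal (to_real g)" by (rule val_attained)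
    have "real_of_ereal (filt C x) = a + to_real g"
      using ax g(2) by (cases "filt C x") auto
    then have lenb: "len k x \<le> ereal b" using c[OF xX] g(1) by (meson not_le)
    then have R: "x \<in> R k" by (auto simp: bar_length_def split: if_splits)
    have "filt C (scl C (c x) (p k x)) = filt C (p k x) - val (c x)"
      by (rule N.l_scale[OF p_grading[OF R]])
    also have "\<dots> = ereal a + len k x"
      unfolding filt_p_eq[OF R] using ax by (cases "filt C x"; cases "len k x"; cases "val (c x)") auto
    also have "\<dots> \<le> ereal (a + b)" using lenb by (cases "len k x") auto
    finally show ?thesis using R by blast
  qed
  let ?z' = "\<Sum>x\<in>X k - S. scl C (c x) x" and ?y = "\<Sum>x\<in>S. scl C (c x) (p k x)"
  have fin: "finite S" "S \<subseteq> X k" using finite_X by (auto simp: S_def)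
  have "bd C ?y = (\<Sum>x\<in>S. scl C (c x) x)"
    using S by (simp add: d.sum d.scale bd_p)
  then have 1: "z = ?z' + bd C ?y"
    unfolding z(1) using fin finite_X by (simp add: sum.subset_diff)
  have 2: "?z' \<in> cycles C k"
    by (intro subspace_sum subspace_scale subspace_cycles X_cycles) auto
  have 3: "filt C ?z' < ereal a"
  proof (rule N.l_sum_less)
    fix x assume "x \<in> X k - S"
    then show "filt C (scl C (c x) x) < ereal a" "scl C (c x) x \<in> grading C k"
      using le[of x] subspace_scale[OF N.subspace_V X_grading] by (auto simp: S_def)
  qed (use finite_X in auto)
  have V: "scl C (c x) (p k x) \<in> grading C (k + 1)" if "x \<in> S" for x
    using S[OF that] by (intro subspace_scale N.subspace_V p_grading) auto
  have 4: "?y \<in> grading C (k + 1)" using V by (intro subspace_sum N.subspace_V)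
  have 5: "filt C ?y \<le> ereal (a + b)" using S V by (intro N.l_sum_le) auto
  show ?thesis using that[OF 1 2 3 4 5] .
qed

text \<open>A nonzero \<open>\<alpha> x\<close> cannot be cancelled by \<open>z'\<close>, which lies
  below level \<open>a\<close>. It thus survives in the boundary of \<open>y\<close>, and
  \<open>filling_coeff\<close> forces \<open>y\<close> to level at least \<open>a\<close> plus the
  length of the bar, which exceeds \<open>a + b\<close>.\<close>

lemma long_bars_independent:
  assumes z': "z' \<in> cycles C k" "filt C z' < ereal a"
    and y: "y \<in> grading C (k + 1)" "filt C y \<le> ereal (a + b)"
    and eq: "z' + bd C y = (\<Sum>x\<in>I. scl C (monomial (\<alpha> x) (g x)) x)"
    and I: "I \<subseteq> X k" "\<And>x. x \<in> I \<Longrightarrow> real_of_ereal (filt C x) = a + to_real (g x)"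
      "\<And>x. x \<in> I \<Longrightarrow> ereal b < len k x"
    and x: "x \<in> I"
  shows "\<alpha> x = 0"
proof (rule ccontr)
  assume \<alpha>: "\<alpha> x \<noteq> 0"
  have xX: "x \<in> X k" using x I(1) by blast
  have "z' \<in> span (X k)" using z'(1) span_X by simp
  then obtain e where e: "z' = (\<Sum>x\<in>X k. scl C (e x) x)"
    "\<And>x. x \<in> X k \<Longrightarrow> filt C (scl C (e x) x) \<le> filt C z'"
    using N.orth_spanE[OF orth_X] by blast
  define h where "h x = (if x \<in> I then monomial (\<alpha> x) (g x) else 0) - e x" for x
  have "(\<Sum>x\<in>I. scl C (monomial (\<alpha> x) (g x)) x) =
      (\<Sum>x\<in>X k. scl C (if x \<in> I then monomial (\<alpha> x) (g x) else 0) x)"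
    using I(1) finite_X by (intro sum.mono_neutral_cong_left) auto
  then have "bd C y = (\<Sum>x\<in>X k. scl C (if x \<in> I then monomial (\<alpha> x) (g x) else 0) x) - z'"
    using eq by (simp add: algebra_simps)
  also have "\<dots> = (\<Sum>x\<in>X k. scl C (h x) x)"
    by (simp add: e(1) h_def scale_left_diff_distrib sum_subtractf)
  finally have bd: "bd C y = (\<Sum>x\<in>X k. scl C (h x) x)" .
  obtain u where u: "filt C x = ereal u" "u = a + to_real (g x)"
    using filt_X[OF xX] I(2)[OF x] by metis
  \<comment> \<open>Level below \<open>a\<close> at \<open>x\<close> means valuation above
    \<open>g x\<close>, so \<open>e x\<close> has no coefficient there.\<close>
  have "filt C x - val (e x) < ereal a"
    using e(2)[OF xX] z'(2) N.l_scale[OF X_grading[OF xX]] by (simp add: order.strict_trans1)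
  then have "ereal (to_real (g x)) < val (e x)"
    using u by (cases "val (e x)") auto
  then have "coeff (e x) (g x) = 0" by (rule coeff_zero_below_val)
  then have cf: "coeff (h x) (g x) \<noteq> 0" using x \<alpha> by (simp add: h_def coeff_diff monomial.rep_eq)
  then have "h x \<noteq> 0" by (auto simp: zero_novikov.rep_eq)
  note fc = filling_coeff[OF y(1) bd xX this]
  have "len k x + ereal a = filt C (p k x) - ereal (to_real (g x))"
    unfolding filt_p_eq[OF fc(1)] using u by (cases "len k x") auto
  also have "\<dots> \<le> filt C (p k x) - val (h x)"
    using val_le[OF cf] by (intro ereal_minus_mono) auto
  also have "\<dots> = filt C (scl C (h x) (p k x))"
    by (rule N.l_scale[OF p_grading[OF fc(1)], symmetric])
  also have "\<dots> \<le> ereal (a + b)" using fc(2) y(2) by simp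
  finally show False using I(3)[OF x] by (cases "len k x") auto
qed

text \<open>For \<open>b \<ge> 0\<close> the tail contains only bars of positive length, all of
  which the concise barcode keeps.\<close>

lemma size_concise_tail:
  assumes "0 \<le> b"
  shows "size {#q \<in># concise_barcode C k. fst q = s \<and> ereal b < snd q#} =
    card {x \<in> X k. residue_class TYPE('g) (real_of_ereal (filt C x)) = s \<and> ereal b < len k x}"
proof -
  have "0 < len k x" if "ereal b < len k x" for x
    using that assms by (metis ereal_less_eq(5) order.strict_trans1)
  then show ?thesis
    unfolding concise_eq
    by (auto simp: filter_mset_image_mset filter_filter_mset finite_X intro!: arg_cong[of _ _ card])
qed

end

section \<open>Bar counts under filtered homotopy equivalence\<close>

lemma chain_map_grading: "chain_map C D \<Phi> \<Longrightarrow> x \<in> grading C k \<Longrightarrow> \<Phi> x \<in> grading D k"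
  unfolding chain_map_def by blast

lemma preserves_filtrationD:
  "preserves_filtration C D \<Phi> \<Longrightarrow> x \<in> grading C k \<Longrightarrow> filt D (\<Phi> x) \<le> filt C x"
  unfolding preserves_filtration_def by blast

locale floer_bars_pair = C: floer_bars C X R p + D: floer_bars D X' R' p'
  for C :: "(('k::field, 'g::real_subgroup) novikov, 'v::ab_group_add) filtered_complex" and X R p
    and D :: "(('k, 'g) novikov, 'w::ab_group_add) filtered_complex" and X' R' p'
begin

text \<open>If \<open>C\<close> had more long bars, some nontrivial combination \<open>z\<close> of
  them over the coefficient field would have an image without coordinates at the long bars of
  \<open>D\<close>. That image is then negligible; mapping back and correcting by the homotopy makes
  \<open>z\<close> negligible too, against independence.\<close>

lemma card_long_bars_le:
  assumes \<Phi>: "chain_map C D \<Phi>" "preserves_filtration C D \<Phi>"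
    and \<Psi>: "chain_map D C \<Psi>" "preserves_filtration D C \<Psi>"
    and hom: "filtered_chain_homotopic C C (\<Psi> \<circ> \<Phi>) id" and b: "0 \<le> b"
  shows "card {x \<in> X k. residue_class TYPE('g) (real_of_ereal (filt C x)) = residue_class TYPE('g) a \<and> ereal b < C.len k x}
    \<le> card {x \<in> X' k. residue_class TYPE('g) (real_of_ereal (filt D x)) = residue_class TYPE('g) a \<and> ereal b < D.len k x}"
    (is "card ?I \<le> card ?J")
proof (rule ccontr)
  assume "\<not> card ?I \<le> card ?J"
  define I where "I = ?I"
  define J where "J = ?J"
  have I: "i \<in> X k" "\<exists>g::'g. real_of_ereal (filt C i) = a + to_real g" "ereal b < C.len k i" if "i \<in> I" for i
    using that by (simp_all add: I_def residue_class_eq_iff)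
  have J: "\<exists>g::'g. real_of_ereal (filt D j) = a + to_real g" if "j \<in> J" for j
    using that by (simp add: J_def residue_class_eq_iff)
  have JI: "j \<in> J" if "j \<in> X' k" "real_of_ereal (filt D j) = a + to_real (h :: 'g)" "ereal b < D.len k j" for j h
    using that by (auto simp add: J_def residue_class_eq_iff)
  have card: "card J < card I" using \<open>\<not> card ?I \<le> card ?J\<close> by (simp add: I_def J_def)
  have fin: "finite I" "finite J" using C.finite_X D.finite_X by (auto simp: I_def J_def)
  interpret \<Phi>: Vector_Spaces.linear "scl C" "scl D" \<Phi> using \<Phi>(1) by (simp add: chain_map_def)
  interpret \<Psi>: Vector_Spaces.linear "scl D" "scl C" \<Psi> using \<Psi>(1) by (simp add: chain_map_def)
  obtain K where K: "Vector_Spaces.linear (scl C) (scl C) K"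
    "\<And>k x. x \<in> grading C k \<Longrightarrow> K x \<in> grading C (k + 1)"
    "\<And>x. \<Psi> (\<Phi> x) - x = bd C (K x) + K (bd C x)" "preserves_filtration C C K"
    using hom unfolding filtered_chain_homotopic_def image_subset_iff comp_def id_def by blast
  interpret K: Vector_Spaces.linear "scl C" "scl C" K by (rule K(1))
  have \<Phi>_gr: "\<Phi> x \<in> grading D k" "filt D (\<Phi> x) \<le> filt C x" if "x \<in> grading C k" for x k
    using chain_map_grading[OF \<Phi>(1)] preserves_filtrationD[OF \<Phi>(2)] that by blast+
  have \<Psi>_gr: "\<Psi> x \<in> grading C k" "filt C (\<Psi> x) \<le> filt D x" if "x \<in> grading D k" for x k
    using chain_map_grading[OF \<Psi>(1)] preserves_filtrationD[OF \<Psi>(2)] that by blast+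
  have \<Phi>_bd: "\<Phi> (bd C x) = bd D (\<Phi> x)" for x using \<Phi>(1) by (simp add: chain_map_def)
  have \<Psi>_bd: "\<Psi> (bd D x) = bd C (\<Psi> x)" for x using \<Psi>(1) by (simp add: chain_map_def)
  obtain g :: "'v \<Rightarrow> 'g" where g: "\<And>x. x \<in> I \<Longrightarrow> real_of_ereal (filt C x) = a + to_real (g x)"
    using I(2) by metis
  obtain g' :: "'w \<Rightarrow> 'g" where g': "\<And>x. x \<in> J \<Longrightarrow> real_of_ereal (filt D x) = a + to_real (g' x)"
    using J by metis
  \<comment> \<open>The power of \<open>T\<close> moves each long bar of the class to level exactly
    \<open>a\<close>.\<close>
  define v where "v i = scl C (monomial 1 (g i)) i" for i
  have v_cyc: "v i \<in> cycles C k" if "i \<in> I" for i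
    unfolding v_def using that by (intro C.subspace_scale C.subspace_cycles C.X_cycles I(1))
  have \<Phi>_cyc: "\<Phi> x \<in> cycles D k" if "x \<in> cycles C k" for x
    using that \<Phi>_gr(1)[of x k] \<Phi>_bd[of x] by (simp add: cycles_def)
  have "\<exists>\<mu>. \<Phi> (v i) = (\<Sum>j\<in>X' k. scl D (\<mu> j) j)" if "i \<in> I" for i
    using \<Phi>_cyc[OF v_cyc[OF that]] unfolding D.span_X[symmetric] D.span_finite[OF D.finite_X] by auto
  then obtain \<mu> where \<mu>: "\<And>i. i \<in> I \<Longrightarrow> \<Phi> (v i) = (\<Sum>j\<in>X' k. scl D (\<mu> i j) j)" by metis
  \<comment> \<open>One unknown for each long bar of \<open>C\<close>, and one equation for each
    long bar of \<open>D\<close>: its coordinate at level \<open>a\<close> vanishes.\<close>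
  obtain \<alpha> :: "'v \<Rightarrow> 'k" where \<alpha>: "\<exists>i\<in>I. \<alpha> i \<noteq> 0"
    "\<And>j. j \<in> J \<Longrightarrow> (\<Sum>i\<in>I. \<alpha> i * coeff (\<mu> i j) (g' j)) = 0"
    using homogeneous_system_nontrivial[OF fin(2,1) card, of "\<lambda>i j. coeff (\<mu> i j) (g' j)"] by blast
  define z where "z = (\<Sum>i\<in>I. scl C (monomial (\<alpha> i) (g i)) i)"
  have zv: "z = (\<Sum>i\<in>I. scl C (monomial (\<alpha> i) 0) (v i))"
    by (simp add: z_def v_def monomial_mult)
  have z_cyc: "z \<in> cycles C k"
    unfolding zv using v_cyc by (intro C.subspace_sum C.subspace_scale C.subspace_cycles)
  then have z_gr: "z \<in> grading C k" and z_bd: "bd C z = 0" by (auto simp: cycles_def)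
  have lz: "filt C z \<le> ereal a"
    unfolding z_def
  proof (rule C.N.l_sum_le)
    fix i assume i: "i \<in> I"
    then have iG: "i \<in> grading C k" "filt C i = ereal (a + to_real (g i))"
      using C.X_grading[OF I(1)[OF i]] C.filt_X[OF I(1)[OF i]] g[OF i] by auto
    then show "scl C (monomial (\<alpha> i) (g i)) i \<in> grading C k"
      by (intro C.subspace_scale C.N.subspace_V)
    show "filt C (scl C (monomial (\<alpha> i) (g i)) i) \<le> ereal a"
      using iG by (cases "\<alpha> i = 0") (simp_all add: C.N.l_scale val_monomial)
  qed
  define c where "c j = (\<Sum>i\<in>I. monomial (\<alpha> i) 0 * \<mu> i j)" for j
  have "\<Phi> z = (\<Sum>i\<in>I. scl D (monomial (\<alpha> i) 0) (\<Sum>j\<in>X' k. scl D (\<mu> i j) j))"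
    unfolding zv \<Phi>.sum \<Phi>.scale by (rule sum.cong[OF refl]) (simp add: \<mu>)
  also have "\<dots> = (\<Sum>j\<in>X' k. scl D (c j) j)"
    unfolding D.scale_sum_right c_def D.scale_sum_left by (subst sum.swap) simp
  finally have \<Phi>z: "\<Phi> z = (\<Sum>j\<in>X' k. scl D (c j) j)" .
  have l\<Phi>z: "filt D (\<Phi> z) \<le> ereal a" using \<Phi>_gr(2)[OF z_gr] lz by simp
  \<comment> \<open>The exponent is determined by the level, since \<open>to_real\<close> is
    injective; hence \<open>h\<close> is the exponent used in the linear system.\<close>
  have "coeff (c j) h = 0"
    if j: "j \<in> X' k" "ereal b < D.len k j" and h: "real_of_ereal (filt D j) = a + to_real h" for j h
  proof -
    have jJ: "j \<in> J" using j h by (intro JI)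
    have "to_real (g' j) = to_real h" using g'[OF jJ] h by simp
    then have "h = g' j" using inj_to_real by (metis injD)
    then show ?thesis using \<alpha>(2)[OF jJ] by (simp add: c_def coeff_sum coeff_monomial_mult)
  qed
  from D.cycle_decomposition[OF \<Phi>z l\<Phi>z b this] obtain z' y where
    zy: "\<Phi> z = z' + bd D y" "z' \<in> cycles D k" "filt D z' < ereal a"
      "y \<in> grading D (k + 1)" "filt D y \<le> ereal (a + b)" by blast
  have z'_gr: "z' \<in> grading D k" "bd D z' = 0" using zy(2) by (auto simp: cycles_def)
  \<comment> \<open>As \<open>z\<close> is a cycle, the homotopy identity reads
    \<open>\<Psi> (\<Phi> z) - z = bd C (K z)\<close>.\<close>
  have "\<Psi> z' + bd C (\<Psi> y - K z) = z"
    using K(3)[of z] by (simp add: zy(1) z_bd \<Psi>.add \<Psi>_bd C.d.diff algebra_simps)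
  moreover have "\<Psi> z' \<in> cycles C k"
    using \<Psi>_gr(1)[OF z'_gr(1)] \<Psi>_bd[of z'] z'_gr(2) by (simp add: cycles_def)
  moreover have "filt C (\<Psi> z') < ereal a"
    using \<Psi>_gr(2)[OF z'_gr(1)] zy(3) by simp
  moreover have Kz: "K z \<in> grading C (k + 1)" "filt C (K z) \<le> ereal a"
    using K(2)[OF z_gr] K(4) z_gr lz unfolding preserves_filtration_def by (auto intro: order_trans)
  moreover have "\<Psi> y - K z \<in> grading C (k + 1)"
    using \<Psi>_gr(1)[OF zy(4)] Kz(1) by (intro C.subspace_diff C.N.subspace_V)
  moreover have "filt C (\<Psi> y - K z) \<le> ereal (a + b)"
  proof -
    have "filt C (\<Psi> y - K z) \<le> max (filt C (\<Psi> y)) (filt C (K z))"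
      using \<Psi>_gr(1)[OF zy(4)] Kz(1) by (rule C.N.l_diff)
    also have "\<dots> \<le> ereal (a + b)"
    proof (rule max.boundedI)
      show "filt C (\<Psi> y) \<le> ereal (a + b)" using \<Psi>_gr(2)[OF zy(4)] zy(5) by simp
      \<comment> \<open>The homotopy does not raise levels, so \<open>K z\<close> stays at level
        \<open>a\<close>, and \<open>0 \<le> b\<close> places it under the bound.\<close>
      show "filt C (K z) \<le> ereal (a + b)" using Kz(2) b by (auto elim: order_trans)
    qed
    finally show ?thesis .
  qed
  ultimately have "\<alpha> i = 0" if "i \<in> I" for i
    using C.long_bars_independent[of "\<Psi> z'" k a "\<Psi> y - K z" b \<alpha> g I i] g that I(1,3)
    unfolding z_def by blast
  then show False using \<alpha>(1) by blast
qed

end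

lemma concise_barcode_invariant:
  fixes C :: "(('k::field, 'g::real_subgroup) novikov, 'v::ab_group_add) filtered_complex"
    and D :: "(('k, 'g) novikov, 'w::ab_group_add) filtered_complex"
  assumes "floer_type_complex C" "floer_type_complex D" "filtered_homotopy_equivalent C D"
  shows "concise_barcode C k = concise_barcode D k"
proof -
  obtain X R p where "floer_bars C X R p"
    using floer_complex.ex_floer_bars[OF floer_complex.intro[OF assms(1)]] by blast
  moreover obtain X' R' p' where "floer_bars D X' R' p'"
    using floer_complex.ex_floer_bars[OF floer_complex.intro[OF assms(2)]] by blast
  ultimately interpret CD: floer_bars_pair C X R p D X' R' p' + DC: floer_bars_pair D X' R' p' C X R p
    by (simp_all add: floer_bars_pair_def)
  obtain \<Phi> \<Psi> where maps: "chain_map C D \<Phi>" "preserves_filtration C D \<Phi>"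
      "chain_map D C \<Psi>" "preserves_filtration D C \<Psi>"
      "filtered_chain_homotopic C C (\<Psi> \<circ> \<Phi>) id" "filtered_chain_homotopic D D (\<Phi> \<circ> \<Psi>) id"
    using assms(3) by (auto simp: filtered_homotopy_equivalent_def)
  show ?thesis
  proof (rule mset_eq_by_tail_counts)
    fix s and b :: real assume b: "0 \<le> b"
    show "size {#q \<in># concise_barcode C k. fst q = s \<and> ereal b < snd q#} =
        size {#q \<in># concise_barcode D k. fst q = s \<and> ereal b < snd q#}"
    \<comment> \<open>The first coordinate may be any set of reals; one that is not a coset occurs
      in neither barcode.\<close>
    proof (cases "s \<in> range (residue_class TYPE('g))")
      case True
      then obtain a where s: "s = residue_class TYPE('g) a" by blast
      show ?thesis
        unfolding CD.C.size_concise_tail[OF b] CD.D.size_concise_tail[OF b] s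
        by (rule antisym[OF CD.card_long_bars_le[OF maps(1-5) b] DC.card_long_bars_le[OF maps(3,4,1,2,6) b]])
    next
      case False
      then have "residue_class TYPE('g) u \<noteq> s" for u by blast
      then show ?thesis
        unfolding CD.C.size_concise_tail[OF b] CD.D.size_concise_tail[OF b] by simp
    qed
  qed (simp_all add: concise_barcode_def)
qed

section \<open>Maps defined on adapted bases\<close>

context floer_complex
begin

text \<open>Meaningful for nonzero homogeneous vectors only: 0 lies in every degree and gets an
  arbitrary one.\<close>

definition degree :: "'v \<Rightarrow> int" where
  "degree x = (SOME k. x \<in> grading C k)"

lemma scl_grading: "x \<in> grading C k \<Longrightarrow> scl C c x \<in> grading C k"
  by (rule subspace_scale[OF N.subspace_V])

lemma decomposition_unique:
  assumes "\<And>k. c k \<in> grading C k" "finite {k. c k \<noteq> 0}" "\<And>k. c' k \<in> grading C k" "finite {k. c' k \<noteq> 0}"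
    and "(\<Sum>k | c k \<noteq> 0. c k) = (\<Sum>k | c' k \<noteq> 0. c' k)"
  shows "c = c'"
proof -
  let ?P = "\<lambda>b. (\<forall>k. b k \<in> grading C k) \<and> finite {k. b k \<noteq> 0} \<and> (\<Sum>k | c k \<noteq> 0. c k) = (\<Sum>k | b k \<noteq> 0. b k)"
  have "\<exists>!b. ?P b" using direct_sum unfolding direct_sum_decomposition_def by blast
  then obtain d where d: "\<And>b. ?P b \<Longrightarrow> b = d" by (elim ex1E) blast
  have "c = d" "c' = d" by (rule d, use assms in simp)+
  then show ?thesis by simp
qed

lemma grading_disjoint:
  assumes "x \<in> grading C j" "x \<in> grading C k" "x \<noteq> 0"
  shows "j = k"
proof -
  define c where "c i m = (if m = i then x else 0)" for i m :: int
  have supp: "{m. c i m \<noteq> 0} = {i}" for i using assms(3) by (auto simp: c_def)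
  have gr: "c i m \<in> grading C m" if "x \<in> grading C i" for i m
    using that subspace_0[OF N.subspace_V] by (simp add: c_def)
  have "c j = c k"
    by (rule decomposition_unique) (simp_all add: gr[OF assms(1)] gr[OF assms(2)] supp, simp add: c_def)
  then have "c j j = c k j" by simp
  then show ?thesis using assms(3) by (auto simp: c_def split: if_splits)
qed

lemma degree_eq: "x \<in> grading C k \<Longrightarrow> x \<noteq> 0 \<Longrightarrow> degree x = k"
  unfolding degree_def by (rule some_equality) (auto dest: grading_disjoint)

lemma graded_sum_eq_0:
  assumes "finite S" "\<And>k. k \<in> S \<Longrightarrow> c k \<in> grading C k" "(\<Sum>k\<in>S. c k) = 0" "k \<in> S"
  shows "c k = 0"
proof -
  define c' where "c' k = (if k \<in> S then c k else 0)" for k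
  have "(\<Sum>k | c' k \<noteq> 0. c' k) = (\<Sum>k\<in>S. c k)"
    using assms(1) by (intro sum.mono_neutral_cong_left) (auto simp: c'_def split: if_splits)
  moreover have "finite {k. c' k \<noteq> 0}"
    using assms(1) by (rule finite_subset[rotated]) (auto simp: c'_def split: if_splits)
  moreover have "c' k \<in> grading C k" for k
    using assms(2) subspace_0[OF N.subspace_V] by (simp add: c'_def)
  ultimately have "c' = (\<lambda>_. 0)"
    using assms(3) subspace_0[OF N.subspace_V] by (intro decomposition_unique) simp_all
  then show ?thesis using assms(4) by (metis c'_def)
qed

text \<open>A linear relation is sorted by degree. Directness of the sum makes each homogeneous part
  vanish, and within one degree independence is assumed.\<close>

lemma independent_Union_graded:
  assumes B: "\<And>k. independent (B k)" "\<And>k. B k \<subseteq> grading C k"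
  shows "independent (\<Union>k. B k)"
  unfolding independent_explicit_module
proof (intro allI impI)
  fix t u v assume t: "finite t" "t \<subseteq> (\<Union>k. B k)" "(\<Sum>v\<in>t. scl C (u v) v) = 0" and v: "v \<in> t"
  have deg: "b \<in> B (degree b)" if "b \<in> t" for b
  proof -
    have "b \<in> (\<Union>k. B k)" using that t(2) by blast
    then obtain k where k: "b \<in> B k" by blast
    then have "b \<noteq> 0" using B(1) dependent_zero by metis
    then show ?thesis using degree_eq[of b k] k B(2) by auto
  qed
  let ?c = "\<lambda>k. \<Sum>v | v \<in> t \<and> degree v = k. scl C (u v) v"
  have "(\<Sum>k\<in>degree ` t. ?c k) = 0"
    using t(3) sum.image_gen[OF t(1), of "\<lambda>v. scl C (u v) v" degree] by simp
  moreover have "?c k \<in> grading C k" for k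
    using deg B(2) by (intro subspace_sum subspace_scale N.subspace_V) auto
  ultimately have "?c (degree v) = 0"
    using v t(1) by (intro graded_sum_eq_0[of "degree ` t" ?c]) auto
  moreover have "{w \<in> t. degree w = degree v} \<subseteq> B (degree v)"
  proof
    fix w assume "w \<in> {w \<in> t. degree w = degree v}"
    then show "w \<in> B (degree v)" using deg[of w] by simp
  qed
  ultimately show "u v = 0"
    using B(1)[of "degree v", unfolded independent_explicit_module, rule_format,
        of "{w \<in> t. degree w = degree v}" u v] t(1) v by simp
qed

lemma span_Union_graded:
  assumes "\<And>k. span (B k) = grading C k"
  shows "span (\<Union>k. B k) = UNIV"
proof -
  have "x \<in> span (\<Union>k. B k)" for x
  proof -
    obtain c where "\<forall>k. c k \<in> grading C k" "x = (\<Sum>k | c k \<noteq> 0. c k)"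
      using direct_sum unfolding direct_sum_decomposition_def by blast
    moreover have "grading C k \<subseteq> span (\<Union>k. B k)" for k
      unfolding assms[symmetric] by (intro span_mono) auto
    ultimately show ?thesis by (auto intro!: span_sum)
  qed
  then show ?thesis by blast
qed

end

context floer_bars
begin

text \<open>The chains paired with cycles of degree \<open>k - 1\<close> live in degree
  \<open>k\<close>, hence the shift.\<close>

definition basis :: "int \<Rightarrow> 'v set" where
  "basis k = p (k - 1) ` R (k - 1) \<union> X k"

lemma orth_basis': "N.orth k (basis k)" and span_basis': "span (basis k) = grading C k"
  using orth_basis[of "k - 1"] span_basis[of "k - 1"] by (simp_all add: basis_def)

lemma basis_cases:
  assumes "b \<in> (\<Union>k. basis k)"
  obtains k where "b \<in> X k" | k x where "x \<in> R k" "b = p k x"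
  using assms by (auto simp: basis_def)

lemma span_all_basis: "span (\<Union>k. basis k) = UNIV"
  by (rule span_Union_graded) (rule span_basis')

lemma ex_linear_on_basis:
  assumes "vector_space t"
  shows "\<exists>F. Vector_Spaces.linear (scl C) t F \<and> (\<forall>k. \<forall>x\<in>X k. F x = f k x) \<and>
    (\<forall>k. \<forall>x\<in>R k. F (p k x) = h k x)"
proof -
  interpret T: vector_space_pair "scl C" t
    using assms vector_space_axioms by (simp add: vector_space_pair_def)
  have "independent (\<Union>k. basis k)"
    using orth_basis' N.orthD(2) by (intro independent_Union_graded N.orth_independent) blast+
  \<comment> \<open>One function must serve the whole union. A basis vector with zero boundary
    belongs to some \<open>X k\<close>; any other is \<open>p k x\<close>, with \<open>x\<close>
    recovered as its boundary and \<open>k\<close> as its degree minus one.\<close>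
  from T.linear_independent_extend[OF this, of "\<lambda>b. if bd C b = 0 then f (degree b) b else h (degree b - 1) (bd C b)"]
  obtain F where F: "Vector_Spaces.linear (scl C) t F"
    "\<And>b k. b \<in> basis k \<Longrightarrow> F b = (if bd C b = 0 then f (degree b) b else h (degree b - 1) (bd C b))"
    by auto
  have "F x = f k x" if "x \<in> X k" for k x
    using that F(2)[of x k] degree_eq[OF X_grading X_nonzero] by (simp add: basis_def bd_X)
  moreover have "F (p k x) = h k x" if "x \<in> R k" for k x
    using that F(2)[of "p k x" "k + 1"] degree_eq[OF p_grading p_nonzero] R_subset X_nonzero[of x k]
    by (auto simp: basis_def bd_p)
  ultimately show ?thesis using F(1) by blast
qed

lemma linear_eq_on_basis:
  assumes "Vector_Spaces.linear (scl C) t F" "Vector_Spaces.linear (scl C) t G"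
    and "\<And>k x. x \<in> X k \<Longrightarrow> F x = G x" "\<And>k x. x \<in> R k \<Longrightarrow> F (p k x) = G (p k x)"
  shows "F x = G x"
proof -
  interpret F: Vector_Spaces.linear "scl C" t F by (rule assms(1))
  interpret T: vector_space_pair "scl C" t ..
  show ?thesis
  proof (rule T.linear_eq_on[OF assms(1,2)])
    show "x \<in> span (\<Union>k. basis k)" by (simp add: span_all_basis)
    show "F b = G b" if "b \<in> (\<Union>k. basis k)" for b
      using that by (cases rule: basis_cases) (simp_all add: assms(3,4))
  qed
qed

text \<open>Orthogonality of the adapted bases reduces the filtration condition to basis vectors.
  The shift \<open>j\<close> is 0 for chain maps and 1 for homotopies.\<close>

lemma graded_filtered_on_basis:
  assumes D: "floer_complex D" and F: "Vector_Spaces.linear (scl C) (scl D) F"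
    and X: "\<And>k x. x \<in> X k \<Longrightarrow> F x \<in> grading D (k + j) \<and> filt D (F x) \<le> filt C x"
    and R: "\<And>k x. x \<in> R k \<Longrightarrow> F (p k x) \<in> grading D (k + 1 + j) \<and> filt D (F (p k x)) \<le> filt C (p k x)"
    and x: "x \<in> grading C k"
  shows "F x \<in> grading D (k + j) \<and> filt D (F x) \<le> filt C x"
proof -
  interpret D: floer_complex D by (rule D)
  interpret F: Vector_Spaces.linear "scl C" "scl D" F by (rule F)
  have "x \<in> span (basis k)" using x span_basis' by simp
  then obtain c where c: "x = (\<Sum>b\<in>basis k. scl C (c b) b)"
    "\<And>b. b \<in> basis k \<Longrightarrow> filt C (scl C (c b) b) \<le> filt C x"
    using N.orth_spanE[OF orth_basis'] by blast
  have Fb: "F b \<in> grading D (k + j)" "filt D (F b) \<le> filt C b" if "b \<in> basis k" for b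
    using that X R[of _ "k - 1"] by (auto simp: basis_def)
  have V: "scl D (c b) (F b) \<in> grading D (k + j)" if "b \<in> basis k" for b
    using Fb(1)[OF that] by (intro D.subspace_scale D.N.subspace_V)
  have "filt D (scl D (c b) (F b)) \<le> filt C x" if b: "b \<in> basis k" for b
  proof -
    have "filt D (scl D (c b) (F b)) = filt D (F b) - val (c b)"
      by (rule D.N.l_scale[OF Fb(1)[OF b]])
    also have "\<dots> \<le> filt C b - val (c b)" using Fb(2)[OF b] by (intro ereal_minus_mono) auto
    also have "\<dots> = filt C (scl C (c b) b)"
      by (rule N.l_scale[OF N.orthD(2)[OF orth_basis' b], symmetric])
    finally show ?thesis using c(2)[OF b] by simp
  qed
  then have "filt D (\<Sum>b\<in>basis k. scl D (c b) (F b)) \<le> filt C x"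
    using V by (intro D.N.l_sum_le)
  moreover have "(\<Sum>b\<in>basis k. scl D (c b) (F b)) \<in> grading D (k + j)"
    using V by (intro D.subspace_sum D.N.subspace_V)
  moreover have "F x = (\<Sum>b\<in>basis k. scl D (c b) (F b))"
    by (simp add: c(1) F.sum F.scale)
  ultimately show ?thesis by simp
qed

lemma len_eq_PInf_iff: "x \<in> X k \<Longrightarrow> len k x = \<infinity> \<longleftrightarrow> x \<notin> R k"
  using filt_X[of x k] filt_p[of x k]
  by (cases "filt C x"; cases "filt C (p k x)") (auto simp: bar_length_def)

lemma len_eq_0: "x \<in> X k \<Longrightarrow> \<not> 0 < len k x \<Longrightarrow> x \<in> R k \<and> filt C (p k x) = filt C x"
proof -
  assume x: "x \<in> X k" "\<not> 0 < len k x"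
  then have l0: "len k x = 0" using len_nonneg[OF x(1)] by simp
  then have "x \<in> R k" by (auto simp: bar_length_def split: if_splits)
  then show ?thesis using filt_p_eq[of x k] l0 by simp
qed

text \<open>The homotopy cancels each bar of length zero by sending its cycle \<open>x\<close> to \<open>- p k x\<close>.\<close>

lemma homotopic_id_kill_zero_bars:
  assumes F: "chain_map C C F" "preserves_filtration C C F"
    and X: "\<And>k x. x \<in> X k \<Longrightarrow> F x = (if 0 < len k x then x else 0)"
    and R: "\<And>k x. x \<in> R k \<Longrightarrow> F (p k x) = (if 0 < len k x then p k x else 0)"
  shows "filtered_chain_homotopic C C F id"
proof -
  interpret pr: vector_space_pair "scl C" "scl C" ..
  have linF: "Vector_Spaces.linear (scl C) (scl C) F" using F(1) by (simp add: chain_map_def)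
  obtain K where K: "Vector_Spaces.linear (scl C) (scl C) K"
    "\<And>k x. x \<in> X k \<Longrightarrow> K x = (if 0 < len k x then 0 else - p k x)"
    "\<And>k x. x \<in> R k \<Longrightarrow> K (p k x) = 0"
    using ex_linear_on_basis[OF vector_space_axioms, of "\<lambda>k x. if 0 < len k x then 0 else - p k x" "\<lambda>_ _. 0"]
    by blast
  interpret K: Vector_Spaces.linear "scl C" "scl C" K by (rule K(1))
  have lins: "Vector_Spaces.linear (scl C) (scl C) (\<lambda>x. F x - x)"
    "Vector_Spaces.linear (scl C) (scl C) (\<lambda>x. bd C (K x) + K (bd C x))"
    using pr.linear_compose_sub[OF linF linear_id[unfolded id_def]]
      pr.linear_compose_add[OF Vector_Spaces.linear_compose[OF K(1) d.linear_axioms]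
        Vector_Spaces.linear_compose[OF d.linear_axioms K(1)]] by (simp_all add: comp_def)
  \<comment> \<open>For a bar of length zero both sides are \<open>- x\<close> at \<open>x\<close>,
    through \<open>bd C (K x)\<close>, and \<open>- p k x\<close> at \<open>p k x\<close>, through
    \<open>K (bd C (p k x))\<close>. For the other bars both sides vanish.\<close>
  have "F x - x = bd C (K x) + K (bd C x)" for x
  proof (rule linear_eq_on_basis[OF lins])
    fix k x assume x: "x \<in> X k"
    show "F x - x = bd C (K x) + K (bd C x)"
      using len_eq_0[OF x] by (simp add: X[OF x] K(2)[OF x] bd_X[OF x] K.zero d.neg bd_p)
  next
    fix k x assume x: "x \<in> R k"
    then have xX: "x \<in> X k" using R_subset by blast
    show "F (p k x) - p k x = bd C (K (p k x)) + K (bd C (p k x))"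
      by (simp add: R[OF x] K(3)[OF x] bd_p[OF x] K(2)[OF xX])
  qed
  \<comment> \<open>\<open>- p k x\<close> is an admissible value because at length zero
    \<open>p k x\<close> has the level of \<open>x\<close>.\<close>
  moreover have gr: "K x \<in> grading C (k + 1) \<and> filt C (K x) \<le> filt C x" if "x \<in> grading C k" for x k
  proof (rule graded_filtered_on_basis[OF floer_complex_axioms K(1) _ _ that])
    fix k x assume x: "x \<in> X k"
    show "K x \<in> grading C (k + 1) \<and> filt C (K x) \<le> filt C x"
      using len_eq_0[OF x] subspace_0[OF N.subspace_V] subspace_neg[OF N.subspace_V p_grading, of x k]
        N.l_minus[OF p_grading, of x k] by (auto simp: K(2)[OF x])
  qed (use subspace_0[OF N.subspace_V] in \<open>simp add: K(3)\<close>)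
  moreover have "preserves_filtration C C id" by (simp add: preserves_filtration_def)
  ultimately show ?thesis
    unfolding filtered_chain_homotopic_def id_def using F(2) K(1)
    by (auto simp: preserves_filtration_def)
qed

end

section \<open>Matching the bars of two complexes\<close>

lemma image_mset_eq_bij_betw:
  assumes "finite A" "finite B" "image_mset f (mset_set A) = image_mset g (mset_set B)"
  shows "\<exists>\<sigma>. bij_betw \<sigma> A B \<and> (\<forall>x\<in>A. g (\<sigma> x) = f x)"
  using assms
proof (induction A arbitrary: B rule: finite_induct)
  case empty
  then show ?case by (auto simp: mset_set_empty_iff bij_betw_def)
next
  case (insert a A)
  then have "f a \<in># image_mset g (mset_set B)" by (metis finite_insert finite_set_mset_mset_set image_eqI insertI1 set_image_mset)
  then obtain b where b: "b \<in> B" "g b = f a" using insert.prems(1) by auto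
  have "mset_set B = add_mset b (mset_set (B - {b}))"
    using insert.prems(1) b(1) by (rule mset_set.remove)
  then have "image_mset f (mset_set A) = image_mset g (mset_set (B - {b}))"
    using insert b by simp
  then obtain \<sigma> where \<sigma>: "bij_betw \<sigma> A (B - {b})" "\<And>x. x \<in> A \<Longrightarrow> g (\<sigma> x) = f x"
    using insert.IH[of "B - {b}"] insert.prems(1) by auto
  have "bij_betw (\<sigma>(a := b)) (insert a A) B"
  proof -
    have "bij_betw (\<sigma>(a := b)) A (B - {b})"
      using \<sigma>(1) insert.hyps(2) by (subst bij_betw_cong[of _ _ \<sigma>]) auto
    then have "bij_betw (\<sigma>(a := b)) (A \<union> {a}) ((B - {b}) \<union> {b})"
      using insert.hyps(2) by (intro bij_betw_combine) (auto simp: bij_betw_def)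
    moreover have "B - {b} \<union> {b} = B" using b(1) by auto
    ultimately show ?thesis by simp
  qed
  moreover have "\<forall>x\<in>insert a A. g ((\<sigma>(a := b)) x) = f x" using \<sigma>(2) b(2) by simp
  ultimately show ?case by blast
qed

context floer_bars_pair
begin

text \<open>Multiplication by \<open>T\<close> to the power \<open>\<gamma> k x\<close> lowers the
  level of \<open>\<sigma> k x\<close> to that of \<open>x\<close>; equal lengths give the same for
  the paired chains. Both ends of a bar of length zero go to 0, so the map still commutes with the
  boundary.\<close>

lemma ex_bar_transfer:
  assumes \<sigma>: "\<And>k x. x \<in> X k \<Longrightarrow> 0 < C.len k x \<Longrightarrow> \<sigma> k x \<in> X' k \<and> D.len k (\<sigma> k x) = C.len k x \<and>
      real_of_ereal (filt D (\<sigma> k x)) = real_of_ereal (filt C x) + to_real (\<gamma> k x)"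
  shows "\<exists>\<Phi>. chain_map C D \<Phi> \<and> preserves_filtration C D \<Phi> \<and>
    (\<forall>k. \<forall>x\<in>X k. \<Phi> x = (if 0 < C.len k x then scl D (monomial 1 (\<gamma> k x)) (\<sigma> k x) else 0)) \<and>
    (\<forall>k. \<forall>x\<in>R k. \<Phi> (p k x) = (if 0 < C.len k x then scl D (monomial 1 (\<gamma> k x)) (p' k (\<sigma> k x)) else 0))"
proof -
  obtain \<Phi> where \<Phi>: "Vector_Spaces.linear (scl C) (scl D) \<Phi>"
    "\<And>k x. x \<in> X k \<Longrightarrow> \<Phi> x = (if 0 < C.len k x then scl D (monomial 1 (\<gamma> k x)) (\<sigma> k x) else 0)"
    "\<And>k x. x \<in> R k \<Longrightarrow> \<Phi> (p k x) = (if 0 < C.len k x then scl D (monomial 1 (\<gamma> k x)) (p' k (\<sigma> k x)) else 0)"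
    using C.ex_linear_on_basis[OF D.vector_space_axioms,
        of "\<lambda>k x. if 0 < C.len k x then scl D (monomial 1 (\<gamma> k x)) (\<sigma> k x) else 0"
           "\<lambda>k x. if 0 < C.len k x then scl D (monomial 1 (\<gamma> k x)) (p' k (\<sigma> k x)) else 0"]
    by blast
  interpret \<Phi>: Vector_Spaces.linear "scl C" "scl D" \<Phi> by (rule \<Phi>(1))
  \<comment> \<open>Membership in \<open>R\<close> is the same as finite length, and
    \<open>\<sigma>\<close> preserves lengths.\<close>
  have \<sigma>R: "\<sigma> k x \<in> R' k" if "x \<in> R k" "0 < C.len k x" for k x
  proof -
    have xX: "x \<in> X k" using that(1) C.R_subset by blast
    show ?thesis
      using \<sigma>[OF xX that(2)] D.len_eq_PInf_iff[of "\<sigma> k x" k] C.len_eq_PInf_iff[OF xX] that(1) by simp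
  qed
  have filt\<sigma>: "filt D (scl D (monomial 1 (\<gamma> k x)) (\<sigma> k x)) = filt C x" if "x \<in> X k" "0 < C.len k x" for k x
    using \<sigma>[OF that] C.filt_X[OF that(1)] D.filt_X[of "\<sigma> k x" k]
    by (cases "filt C x"; cases "filt D (\<sigma> k x)")
       (auto simp: D.N.l_scale[OF D.X_grading] val_monomial)
  have filtp: "filt D (scl D (monomial 1 (\<gamma> k x)) (p' k (\<sigma> k x))) = filt C (p k x)"
    if "x \<in> R k" "0 < C.len k x" for k x
  proof -
    have xX: "x \<in> X k" using that(1) C.R_subset by blast
    note s = \<sigma>[OF xX that(2)] and sR = \<sigma>R[OF that]
    show ?thesis
      unfolding D.N.l_scale[OF D.p_grading[OF sR]] D.filt_p_eq[OF sR] C.filt_p_eq[OF that(1)]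
      using s C.filt_X[OF xX] D.filt_X[of "\<sigma> k x" k]
      by (cases "filt C x"; cases "filt D (\<sigma> k x)"; cases "C.len k x") (auto simp: val_monomial)
  qed
  have gr: "\<Phi> x \<in> grading D k \<and> filt D (\<Phi> x) \<le> filt C x" if "x \<in> grading C k" for x k
  proof (rule C.graded_filtered_on_basis[OF D.floer_complex_axioms \<Phi>(1), of 0, simplified])
    fix k x assume x: "x \<in> X k"
    then show "\<Phi> x \<in> grading D k \<and> filt D (\<Phi> x) \<le> filt C x"
      using \<sigma>[OF x] filt\<sigma>[OF x] D.subspace_0[OF D.N.subspace_V]
      by (auto simp: \<Phi>(2) intro!: D.scl_grading[OF D.X_grading])
  next
    fix k x assume x: "x \<in> R k"
    then show "\<Phi> (p k x) \<in> grading D (k + 1) \<and> filt D (\<Phi> (p k x)) \<le> filt C (p k x)"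
      using \<sigma>R[OF x] filtp[OF x] D.subspace_0[OF D.N.subspace_V]
      by (auto simp: \<Phi>(3) intro!: D.scl_grading[OF D.p_grading])
  qed (fact that)
  have "\<Phi> (bd C x) = bd D (\<Phi> x)" for x
  proof -
    have "(\<Phi> \<circ> bd C) x = (bd D \<circ> \<Phi>) x"
    proof (rule C.linear_eq_on_basis[of "scl D"])
      show "Vector_Spaces.linear (scl C) (scl D) (\<Phi> \<circ> bd C)" "Vector_Spaces.linear (scl C) (scl D) (bd D \<circ> \<Phi>)"
        by (rule Vector_Spaces.linear_compose[OF C.d.linear_axioms \<Phi>(1)]
            Vector_Spaces.linear_compose[OF \<Phi>(1) D.d.linear_axioms])+
      fix k x assume x: "x \<in> X k"
      then show "(\<Phi> \<circ> bd C) x = (bd D \<circ> \<Phi>) x"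
        using \<sigma>[OF x] D.bd_X[of "\<sigma> k x" k]
        by (auto simp: C.bd_X \<Phi>(2) \<Phi>.zero D.d.zero D.d.scale)
    next
      fix k x assume x: "x \<in> R k"
      then have xX: "x \<in> X k" using C.R_subset by blast
      show "(\<Phi> \<circ> bd C) (p k x) = (bd D \<circ> \<Phi>) (p k x)"
        using \<sigma>R[OF x] by (simp add: C.bd_p[OF x] \<Phi>(2)[OF xX] \<Phi>(3)[OF x] D.d.zero D.d.scale D.bd_p)
    qed
    then show ?thesis by simp
  qed
  then have "chain_map C D \<Phi>" "preserves_filtration C D \<Phi>"
    using gr \<Phi>(1) by (auto simp: chain_map_def preserves_filtration_def)
  then show ?thesis using \<Phi>(2,3) by blast
qed

text \<open>On bars of positive length the opposite powers of \<open>T\<close> cancel, so the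
  composite is the identity there and zero on the rest. The other composite is the same statement
  with the complexes interchanged.\<close>

lemma transfer_round_trip:
  assumes \<Phi>: "chain_map C D \<Phi>" "preserves_filtration C D \<Phi>"
    "\<And>k x. x \<in> X k \<Longrightarrow> \<Phi> x = (if 0 < C.len k x then scl D (monomial 1 (\<gamma> k x)) (\<sigma> k x) else 0)"
    "\<And>k x. x \<in> R k \<Longrightarrow> \<Phi> (p k x) = (if 0 < C.len k x then scl D (monomial 1 (\<gamma> k x)) (p' k (\<sigma> k x)) else 0)"
    and \<Psi>: "chain_map D C \<Psi>" "preserves_filtration D C \<Psi>"
    "\<And>k x. x \<in> X' k \<Longrightarrow> \<Psi> x = (if 0 < D.len k x then scl C (monomial 1 (\<gamma>' k x)) (\<tau> k x) else 0)"
    "\<And>k x. x \<in> R' k \<Longrightarrow> \<Psi> (p' k x) = (if 0 < D.len k x then scl C (monomial 1 (\<gamma>' k x)) (p k (\<tau> k x)) else 0)"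
    and rel: "\<And>k x. x \<in> X k \<Longrightarrow> 0 < C.len k x \<Longrightarrow> \<sigma> k x \<in> X' k \<and> D.len k (\<sigma> k x) = C.len k x \<and>
      \<tau> k (\<sigma> k x) = x \<and> \<gamma>' k (\<sigma> k x) = - \<gamma> k x"
  shows "filtered_chain_homotopic C C (\<Psi> \<circ> \<Phi>) id"
proof (rule C.homotopic_id_kill_zero_bars)
  interpret \<Phi>: Vector_Spaces.linear "scl C" "scl D" \<Phi> using \<Phi>(1) by (simp add: chain_map_def)
  interpret \<Psi>: Vector_Spaces.linear "scl D" "scl C" \<Psi> using \<Psi>(1) by (simp add: chain_map_def)
  show "chain_map C C (\<Psi> \<circ> \<Phi>)"
    using \<Phi>(1) \<Psi>(1) Vector_Spaces.linear_compose[of "scl C" "scl D" \<Phi> "scl C" \<Psi>]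
    by (simp add: chain_map_def image_subset_iff)
  show "preserves_filtration C C (\<Psi> \<circ> \<Phi>)"
    using preserves_filtrationD[OF \<Phi>(2)] preserves_filtrationD[OF \<Psi>(2)] chain_map_grading[OF \<Phi>(1)]
    unfolding preserves_filtration_def comp_def by (meson order_trans)
  fix k x
  show "(\<Psi> \<circ> \<Phi>) x = (if 0 < C.len k x then x else 0)" if x: "x \<in> X k"
    using rel[OF x] \<Psi>(3)[of "\<sigma> k x" k]
    by (cases "0 < C.len k x")
       (simp_all add: \<Phi>(3)[OF x] \<Psi>.zero \<Psi>.scale monomial_mult one_eq_monomial[symmetric])
  show "(\<Psi> \<circ> \<Phi>) (p k x) = (if 0 < C.len k x then p k x else 0)" if x: "x \<in> R k"
  proof -
    have xX: "x \<in> X k" using x C.R_subset by blast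
    have "\<sigma> k x \<in> R' k" if "0 < C.len k x"
      using rel[OF xX that] D.len_eq_PInf_iff[of "\<sigma> k x" k] C.len_eq_PInf_iff[OF xX] x by simp
    then show ?thesis
      using rel[OF xX] \<Psi>(4)[of "\<sigma> k x" k]
      by (cases "0 < C.len k x")
         (simp_all add: \<Phi>(4)[OF x] \<Psi>.zero \<Psi>.scale monomial_mult one_eq_monomial[symmetric])
  qed
qed

lemma homotopy_equivalent_if_concise_eq:
  assumes eq: "\<And>k. concise_barcode C k = concise_barcode D k"
  shows "filtered_homotopy_equivalent C D"
proof -
  interpret DC: floer_bars_pair D X' R' p' C X R p by unfold_locales
  define A where "A k = {x \<in> X k. 0 < C.len k x}" for k
  define B where "B k = {x \<in> X' k. 0 < D.len k x}" for k
  have fin: "finite (A k)" "finite (B k)" for k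
    using C.finite_X D.finite_X by (auto simp: A_def B_def)
  have "\<exists>\<sigma>. bij_betw \<sigma> (A k) (B k) \<and> (\<forall>x\<in>A k.
      (residue_class TYPE('g) (real_of_ereal (filt D (\<sigma> x))), D.len k (\<sigma> x)) =
      (residue_class TYPE('g) (real_of_ereal (filt C x)), C.len k x))" for k
    using eq[of k] fin
    unfolding C.concise_eq D.concise_eq
    by (intro image_mset_eq_bij_betw) (simp_all add: A_def B_def C.finite_X D.finite_X)
  then obtain \<sigma> where \<sigma>: "\<And>k. bij_betw (\<sigma> k) (A k) (B k)"
    "\<And>k x. x \<in> A k \<Longrightarrow> residue_class TYPE('g) (real_of_ereal (filt D (\<sigma> k x))) =
        residue_class TYPE('g) (real_of_ereal (filt C x))"
    "\<And>k x. x \<in> A k \<Longrightarrow> D.len k (\<sigma> k x) = C.len k x" by (metis Pair_inject)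
  define \<gamma> where "\<gamma> k x = (SOME g::'g. real_of_ereal (filt D (\<sigma> k x)) = real_of_ereal (filt C x) + to_real g)" for k x
  have \<gamma>: "real_of_ereal (filt D (\<sigma> k x)) = real_of_ereal (filt C x) + to_real (\<gamma> k x)" if "x \<in> A k" for k x
    unfolding \<gamma>_def by (rule someI_ex) (rule \<sigma>(2)[OF that, unfolded residue_class_eq_iff])
  define \<tau> where "\<tau> k = the_inv_into (A k) (\<sigma> k)" for k
  \<comment> \<open>The return map uses the negated exponent of the matched bar, so that the product
    of the two factors is exactly 1.\<close>
  define \<gamma>' where "\<gamma>' k y = - \<gamma> k (\<tau> k y)" for k y
  have inj: "inj_on (\<sigma> k) (A k)" and im: "\<sigma> k ` A k = B k" for k using \<sigma>(1) by (auto simp: bij_betw_def)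
  have \<sigma>B: "\<sigma> k x \<in> B k" "\<tau> k (\<sigma> k x) = x" if "x \<in> A k" for k x
    using im that the_inv_into_f_f[OF inj that] by (auto simp: \<tau>_def)
  have \<tau>A: "\<tau> k y \<in> A k" "\<sigma> k (\<tau> k y) = y" if "y \<in> B k" for k y
    using that im[of k] the_inv_into_into[OF inj, of y k] f_the_inv_into_f[OF inj, of y k] by (auto simp: \<tau>_def)
  obtain \<Phi> where \<Phi>: "chain_map C D \<Phi>" "preserves_filtration C D \<Phi>"
    "\<And>k x. x \<in> X k \<Longrightarrow> \<Phi> x = (if 0 < C.len k x then scl D (monomial 1 (\<gamma> k x)) (\<sigma> k x) else 0)"
    "\<And>k x. x \<in> R k \<Longrightarrow> \<Phi> (p k x) = (if 0 < C.len k x then scl D (monomial 1 (\<gamma> k x)) (p' k (\<sigma> k x)) else 0)"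
    using ex_bar_transfer[of \<sigma> \<gamma>] \<gamma> \<sigma>(3) \<sigma>B(1) by (auto simp: A_def B_def)
  obtain \<Psi> where \<Psi>: "chain_map D C \<Psi>" "preserves_filtration D C \<Psi>"
    "\<And>k x. x \<in> X' k \<Longrightarrow> \<Psi> x = (if 0 < D.len k x then scl C (monomial 1 (\<gamma>' k x)) (\<tau> k x) else 0)"
    "\<And>k x. x \<in> R' k \<Longrightarrow> \<Psi> (p' k x) = (if 0 < D.len k x then scl C (monomial 1 (\<gamma>' k x)) (p k (\<tau> k x)) else 0)"
  proof -
    have "\<tau> k y \<in> X k \<and> C.len k (\<tau> k y) = D.len k y \<and>
      real_of_ereal (filt C (\<tau> k y)) = real_of_ereal (filt D y) + to_real (\<gamma>' k y)"
      if "y \<in> X' k" "0 < D.len k y" for k y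
    proof -
      have y: "y \<in> B k" using that by (simp add: B_def)
      show ?thesis
        using \<tau>A[OF y] \<sigma>(3)[OF \<tau>A(1)[OF y]] \<gamma>[OF \<tau>A(1)[OF y]] by (auto simp: A_def \<gamma>'_def to_real_minus)
    qed
    from DC.ex_bar_transfer[of \<tau> \<gamma>', OF this] show ?thesis using that by blast
  qed
  have rel: "\<sigma> k x \<in> X' k \<and> D.len k (\<sigma> k x) = C.len k x \<and> \<tau> k (\<sigma> k x) = x \<and> \<gamma>' k (\<sigma> k x) = - \<gamma> k x"
    if "x \<in> X k" "0 < C.len k x" for k x
    using that \<sigma>B[of x k] \<sigma>(3)[of x k] by (simp add: A_def B_def \<gamma>'_def)
  have rel': "\<tau> k y \<in> X k \<and> C.len k (\<tau> k y) = D.len k y \<and> \<sigma> k (\<tau> k y) = y \<and> \<gamma> k (\<tau> k y) = - \<gamma>' k y"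
    if "y \<in> X' k" "0 < D.len k y" for k y
    using that \<tau>A[of y k] \<sigma>(3)[of "\<tau> k y" k] by (simp add: A_def B_def \<gamma>'_def)
  show ?thesis
    unfolding filtered_homotopy_equivalent_def
    using \<Phi>(1,2) \<Psi>(1,2) transfer_round_trip[OF \<Phi> \<Psi> rel] DC.transfer_round_trip[OF \<Psi> \<Phi> rel'] by blast
qed

end

theorem theoremB:
  fixes C :: "(('k::field, 'g::real_subgroup) novikov, 'v::ab_group_add) filtered_complex"
    and D :: "(('k, 'g) novikov, 'w::ab_group_add) filtered_complex"
  assumes "floer_type_complex C" and "floer_type_complex D"
  shows "filtered_homotopy_equivalent C D \<longleftrightarrow>
         (\<forall>k. concise_barcode C k = concise_barcode D k)"
proof
  assume "filtered_homotopy_equivalent C D"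
  then show "\<forall>k. concise_barcode C k = concise_barcode D k"
    using concise_barcode_invariant[OF assms] by blast
next
  assume eq: "\<forall>k. concise_barcode C k = concise_barcode D k"
  obtain X R p where "floer_bars C X R p"
    using floer_complex.ex_floer_bars[OF floer_complex.intro[OF assms(1)]] by blast
  moreover obtain X' R' p' where "floer_bars D X' R' p'"
    using floer_complex.ex_floer_bars[OF floer_complex.intro[OF assms(2)]] by blast
  ultimately interpret floer_bars_pair C X R p D X' R' p'
    by (rule floer_bars_pair.intro)
  show "filtered_homotopy_equivalent C D"
    using eq by (intro homotopy_equivalent_if_concise_eq) simp
qed

end
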